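(* Given a proof graph $\langle P\mid\Gamma\rangle$ and a cut node $\odot$ in $\Gamma$, there is an equivalent proof graph $\langle P'\mid\Gamma\rangle$ in which that cut node is ready, i.e., can be reduced.
   Context: Write ⅋ for par and $\odot$ for the cut connective. A proof graph $\langle P\mid\Gamma\rangle$ is an MLL linking tree $P$ (generated by $\mathsf1\mid a\otimes a^\perp\mid a^\perp\otimes a\mid\bot\otimes L\mid L\otimes\bot\mid L⅋L$) and a sequent with cuts $\Gamma$ (cuts $A\odot A^\perp$ occur only as roots) with the same leaves, such that every switching (deleting one child edge per ⅋-node; $\odot$ acts like $\otimes$) is connected and acyclic. Equivalence $\sim$ of proof graphs is generated by commutativity/associativity of ⅋ in the linking, commutativity of $\otimes$, $\bot_i\otimes(Q\otimes\bot_j)\sim(\bot_i\otimes Q)\otimes\bot_j$ and $Q⅋(R\otimes\bot_i)\sim(Q⅋R)\otimes\bot_i$ (side condition: in every switching with also the edge from $\bot_i$ to its parent removed, no node of $Q$ is connected to $\bot_i$). The cut reduction steps on graphs are: $\langle P\mid(A⅋B)\odot(B^\perp\otimes A^\perp),\Gamma\rangle\to\langle P\mid A\odot A^\perp,B\odot B^\perp,\Gamma\rangle$; $\langle P[(a_h^\perp\otimes a_i)⅋(a_j^\perp\otimes a_k)]\mid a_i\odot a_j^\perp,\Gamma\rangle\to\langle P[a_h^\perp\otimes a_k]\mid\Gamma\rangle$; $\langle P[(Q\otimes\bot_i)⅋\mathsf1_j]\mid\bot_i\odot\mathsf1_j,\Gamma\rangle\to\langle P[Q]\mid\Gamma\rangle$.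 A cut node is ready in a proof graph if one of these steps applies to it there. *)

theory Defs
  imports Main
begin

text \<open>Leaf kinds: a positive atom a, a negative atom a-perp, the unit 1, and bottom.
  Every leaf occurrence carries a unique identifier (a natural number).\<close>
datatype lkind = PosAt nat | NegAt nat | LOne | LBot

type_synonym leaf = "nat \<times> lkind"

text \<open>Binary trees with tensor and par nodes; used both for formulas of the
  sequent and for linking trees.\<close>
datatype tree = Leaf leaf | Tens tree tree | Par tree tree

datatype sel = Form tree | Cut tree tree

fun leaves :: "tree \<Rightarrow> leaf list" where
  "leaves (Leaf l) = [l]"
| "leaves (Tens A B) = leaves A @ leaves B"
| "leaves (Par A B) = leaves A @ leaves B"

fun sel_leaves :: "sel \<Rightarrow> leaf list" where
  "sel_leaves (Form A) = leaves A"
| "sel_leaves (Cut A B) = leaves A @ leaves B"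

inductive is_linking :: "tree \<Rightarrow> bool" where
  lk_one: "is_linking (Leaf (i, LOne))"
| lk_ax1: "is_linking (Tens (Leaf (i, PosAt a)) (Leaf (j, NegAt a)))"
| lk_ax2: "is_linking (Tens (Leaf (i, NegAt a)) (Leaf (j, PosAt a)))"
| lk_botl: "is_linking L \<Longrightarrow> is_linking (Tens (Leaf (i, LBot)) L)"
| lk_botr: "is_linking L \<Longrightarrow> is_linking (Tens L (Leaf (i, LBot)))"
| lk_par: "is_linking L1 \<Longrightarrow> is_linking L2 \<Longrightarrow> is_linking (Par L1 L2)"

inductive is_dual :: "tree \<Rightarrow> tree \<Rightarrow> bool" where
  du_pn: "is_dual (Leaf (i, PosAt a)) (Leaf (j, NegAt a))"
| du_np: "is_dual (Leaf (i, NegAt a)) (Leaf (j, PosAt a))"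
| du_ob: "is_dual (Leaf (i, LOne)) (Leaf (j, LBot))"
| du_bo: "is_dual (Leaf (i, LBot)) (Leaf (j, LOne))"
| du_pt: "is_dual A A' \<Longrightarrow> is_dual B B' \<Longrightarrow> is_dual (Par A B) (Tens B' A')"
| du_tp: "is_dual A A' \<Longrightarrow> is_dual B B' \<Longrightarrow> is_dual (Tens A B) (Par B' A')"

fun wf_sel :: "sel \<Rightarrow> bool" where
  "wf_sel (Form A) = True"
| "wf_sel (Cut A B) = is_dual A B"

fun subtree_at :: "tree \<Rightarrow> bool list \<Rightarrow> tree option" where
  "subtree_at T [] = Some T"
| "subtree_at (Leaf l) (b # p) = None"
| "subtree_at (Tens A B) (False # p) = subtree_at A p"
| "subtree_at (Tens A B) (True # p) = subtree_at B p"
| "subtree_at (Par A B) (False # p) = subtree_at A p"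
| "subtree_at (Par A B) (True # p) = subtree_at B p"

fun replace_at :: "tree \<Rightarrow> bool list \<Rightarrow> tree \<Rightarrow> tree" where
  "replace_at T [] Y = Y"
| "replace_at (Leaf l) (b # p) Y = Leaf l"
| "replace_at (Tens A B) (False # p) Y = Tens (replace_at A p Y) B"
| "replace_at (Tens A B) (True # p) Y = Tens A (replace_at B p Y)"
| "replace_at (Par A B) (False # p) Y = Par (replace_at A p Y) B"
| "replace_at (Par A B) (True # p) Y = Par A (replace_at B p Y)"

definition is_subtree :: "tree \<Rightarrow> tree \<Rightarrow> bool" where
  "is_subtree X T \<longleftrightarrow> (\<exists>p. subtree_at T p = Some X)"

text \<open>Nodes: leaves (shared between linking and sequent, identified by their id),
  inner nodes of the linking (by path), inner nodes of the k-th sequent element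
  (by path; for a cut the first step selects the side), and cut nodes.\<close>
datatype node = NLeaf nat | NP "bool list" | NG nat "bool list" | NC nat

fun rnode :: "(bool list \<Rightarrow> node) \<Rightarrow> bool list \<Rightarrow> tree \<Rightarrow> node" where
  "rnode mk p (Leaf l) = NLeaf (fst l)"
| "rnode mk p (Tens A B) = mk p"
| "rnode mk p (Par A B) = mk p"

fun tnodes :: "(bool list \<Rightarrow> node) \<Rightarrow> bool list \<Rightarrow> tree \<Rightarrow> node set" where
  "tnodes mk p (Leaf l) = {NLeaf (fst l)}"
| "tnodes mk p (Tens A B) = insert (mk p) (tnodes mk (p @ [False]) A \<union> tnodes mk (p @ [True]) B)"
| "tnodes mk p (Par A B) = insert (mk p) (tnodes mk (p @ [False]) A \<union> tnodes mk (p @ [True]) B)"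

fun swedges :: "(node \<Rightarrow> bool) \<Rightarrow> (bool list \<Rightarrow> node) \<Rightarrow> bool list \<Rightarrow> tree \<Rightarrow> (node \<times> node) set" where
  "swedges s mk p (Leaf l) = {}"
| "swedges s mk p (Tens A B) =
     {(mk p, rnode mk (p @ [False]) A), (mk p, rnode mk (p @ [True]) B)}
     \<union> swedges s mk (p @ [False]) A \<union> swedges s mk (p @ [True]) B"
| "swedges s mk p (Par A B) =
     (if s (mk p) then {(mk p, rnode mk (p @ [True]) B)} else {(mk p, rnode mk (p @ [False]) A)})
     \<union> swedges s mk (p @ [False]) A \<union> swedges s mk (p @ [True]) B"

fun sel_nodes :: "nat \<Rightarrow> sel \<Rightarrow> node set" where
  "sel_nodes k (Form A) = tnodes (NG k) [] A"
| "sel_nodes k (Cut A B) = insert (NC k) (tnodes (NG k) [False] A \<union> tnodes (NG k) [True] B)"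

fun sel_edges :: "(node \<Rightarrow> bool) \<Rightarrow> nat \<Rightarrow> sel \<Rightarrow> (node \<times> node) set" where
  "sel_edges s k (Form A) = swedges s (NG k) [] A"
| "sel_edges s k (Cut A B) =
     {(NC k, rnode (NG k) [False] A), (NC k, rnode (NG k) [True] B)}
     \<union> swedges s (NG k) [False] A \<union> swedges s (NG k) [True] B"

definition graph_nodes :: "tree \<Rightarrow> sel list \<Rightarrow> node set" where
  "graph_nodes P \<Gamma> = tnodes NP [] P \<union> (\<Union>k<length \<Gamma>. sel_nodes k (\<Gamma> ! k))"

definition sw_graph :: "(node \<Rightarrow> bool) \<Rightarrow> tree \<Rightarrow> sel list \<Rightarrow> (node \<times> node) set" where
  "sw_graph s P \<Gamma> = swedges s NP [] P \<union> (\<Union>k<length \<Gamma>. sel_edges s k (\<Gamma> ! k))"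

definition adj :: "(node \<times> node) set \<Rightarrow> node \<Rightarrow> node \<Rightarrow> bool" where
  "adj E u v \<longleftrightarrow> (u, v) \<in> E \<or> (v, u) \<in> E"

definition connected_on :: "node set \<Rightarrow> (node \<times> node) set \<Rightarrow> bool" where
  "connected_on V E \<longleftrightarrow> (\<forall>u\<in>V. \<forall>v\<in>V. (adj E)\<^sup>*\<^sup>* u v)"

definition acyclic_on :: "(node \<times> node) set \<Rightarrow> bool" where
  "acyclic_on E \<longleftrightarrow> \<not> (\<exists>vs. 3 \<le> length vs \<and> distinct vs \<and>
       (\<forall>i. Suc i < length vs \<longrightarrow> adj E (vs ! i) (vs ! Suc i)) \<and> adj E (last vs) (hd vs))"

definition proof_graph :: "tree \<Rightarrow> sel list \<Rightarrow> bool" where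
  "proof_graph P \<Gamma> \<longleftrightarrow>
     is_linking P \<and> (\<forall>k<length \<Gamma>. wf_sel (\<Gamma> ! k)) \<and>
     distinct (map fst (leaves P)) \<and>
     distinct (map fst (concat (map sel_leaves \<Gamma>))) \<and>
     set (leaves P) = set (concat (map sel_leaves \<Gamma>)) \<and>
     (\<forall>s. connected_on (graph_nodes P \<Gamma>) (sw_graph s P \<Gamma>) \<and> acyclic_on (sw_graph s P \<Gamma>))"

inductive eq_rule :: "tree \<Rightarrow> tree \<Rightarrow> bool" where
  par_comm: "eq_rule (Par Q R) (Par R Q)"
| par_assoc: "eq_rule (Par (Par Q R) S) (Par Q (Par R S))"
| tens_comm: "eq_rule (Tens Q R) (Tens R Q)"
| bot_assoc: "eq_rule (Tens (Leaf (i, LBot)) (Tens Q (Leaf (j, LBot))))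
                      (Tens (Tens (Leaf (i, LBot)) Q) (Leaf (j, LBot)))"

text \<open>Side condition of Q par (R (x) bot_i) ~ (Q par R) (x) bot_i, where the left-hand
  side sits at position p of the linking P: in every switching with also the edge
  from bot_i to its parent removed, no node of Q is connected to bot_i.\<close>
definition bot_side_cond :: "tree \<Rightarrow> sel list \<Rightarrow> bool list \<Rightarrow> tree \<Rightarrow> nat \<Rightarrow> bool" where
  "bot_side_cond P \<Gamma> p Q i \<longleftrightarrow>
     (\<forall>s. \<forall>q\<in>tnodes NP (p @ [False]) Q.
        \<not> (adj (sw_graph s P \<Gamma> - {(NP (p @ [True]), NLeaf i)}))\<^sup>*\<^sup>* q (NLeaf i))"

definition eq_step :: "sel list \<Rightarrow> tree \<Rightarrow> tree \<Rightarrow> bool" where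
  "eq_step \<Gamma> P P' \<longleftrightarrow>
     (\<exists>p X Y. subtree_at P p = Some X \<and> P' = replace_at P p Y \<and>
        (eq_rule X Y \<or>
         (\<exists>Q R i. X = Par Q (Tens R (Leaf (i, LBot))) \<and> Y = Tens (Par Q R) (Leaf (i, LBot)) \<and>
                  bot_side_cond P \<Gamma> p Q i)))"

definition pg_equiv :: "sel list \<Rightarrow> tree \<Rightarrow> tree \<Rightarrow> bool" where
  "pg_equiv \<Gamma> = (\<lambda>P P'. proof_graph P \<Gamma> \<and> proof_graph P' \<Gamma> \<and>
                        (eq_step \<Gamma> P P' \<or> eq_step \<Gamma> P' P))\<^sup>*\<^sup>*"

text \<open>A cut A cut B (read up to the symmetry of the cut) is ready in P if one of the
  three cut-reduction steps applies to it.\<close>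
definition reducible_cut :: "tree \<Rightarrow> tree \<Rightarrow> tree \<Rightarrow> bool" where
  "reducible_cut P A B \<longleftrightarrow>
     (\<exists>X Y X' Y'. A = Par X Y \<and> B = Tens Y' X') \<or>
     (\<exists>a h i j k. A = Leaf (i, PosAt a) \<and> B = Leaf (j, NegAt a) \<and>
        is_subtree (Par (Tens (Leaf (h, NegAt a)) (Leaf (i, PosAt a)))
                        (Tens (Leaf (j, NegAt a)) (Leaf (k, PosAt a)))) P) \<or>
     (\<exists>i j Q. A = Leaf (i, LBot) \<and> B = Leaf (j, LOne) \<and>
        is_subtree (Par (Tens Q (Leaf (i, LBot))) (Leaf (j, LOne))) P)"

fun ready_sel :: "tree \<Rightarrow> sel \<Rightarrow> bool" where
  "ready_sel P (Form A) = False"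
| "ready_sel P (Cut A B) = (reducible_cut P A B \<or> reducible_cut P B A)"

definition ready :: "tree \<Rightarrow> sel list \<Rightarrow> nat \<Rightarrow> bool" where
  "ready P \<Gamma> k \<longleftrightarrow> k < length \<Gamma> \<and> ready_sel P (\<Gamma> ! k)"

fun is_cut :: "sel \<Rightarrow> bool" where
  "is_cut (Form A) = False"
| "is_cut (Cut A B) = True"

end

theory Submission
  imports Defs "HOL-Library.Multiset"
begin

text \<open>
  A cut of compound formulas is ready as it stands. For a cut between two leaves, consider the smallest
  subtree of the linking that contains both. Its root is not a tensor, since some switching would
  then contain a cycle through the cut; so it is a par of U and V. It is shrunk until U and V are the
  two trees required by the reduction step: associativity and commutativity remove a par at the root
  of U or V, and a root \<open>V = V' \<otimes> \<bottom>\<^sub>m\<close> is removed by moving \<open>\<bottom>\<^sub>m\<close> out of the par. If the side condition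
  for this move fails, some leaf q of U is connected to \<open>\<bottom>\<^sub>m\<close> outside U and V. When U already
  has the required form, this closes a cycle through the cut. When \<open>U = U' \<otimes> \<bottom>\<^sub>n\<close> and the move of
  \<open>\<bottom>\<^sub>n\<close> fails as well, some leaf r of V is connected to \<open>\<bottom>\<^sub>n\<close>, possibly in a different switching;
  merging the two switchings connects \<open>\<bottom>\<^sub>n\<close> to \<open>\<bottom>\<^sub>m\<close>, or \<open>\<bottom>\<^sub>n\<close> to q, or q to \<open>\<bottom>\<^sub>m\<close> and r to \<open>\<bottom>\<^sub>n\<close>
  at once, and each of these closes a cycle.

  That the steps preserve correctness is read off from two-colourings of the leaves: all switchings
  are connected iff every colouring compatible with some switching is constant. Acyclicity
  then follows by counting edges.
\<close>

section \<open>Switched graphs\<close>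

text \<open>Nodes of the linking are named by their paths, so a rewriting step renames nodes and the
  switchings of the two graphs cannot be compared edge by edge. Leaves keep their identifiers. This
  is why correctness is phrased through leaf colours: a subtree affects its surroundings only
  through the colouring of its leaves and the colour of its root. The cycle arguments need the
  opposite view, because a failed side condition yields a connection in one particular switching.
  That connection is first confined to the part outside the par, where it is independent of the
  switches at and below the par. Those switches can then be set anew, towards whichever leaves close
  a cycle. Since \<open>pg_equiv\<close> demands a proof graph at both ends of every step, each
  single move has to be shown correct, not only the final linking.\<close>

abbreviation conn :: "(node \<times> node) set \<Rightarrow> node \<Rightarrow> node \<Rightarrow> bool" where
  "conn E \<equiv> (adj E)\<^sup>*\<^sup>*"

lemma conn_sym: "conn E a b \<Longrightarrow> conn E b a"
proof (induction rule: rtranclp_induct)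
  case (step y z)
  then have "adj E z y" by (auto simp: adj_def)
  with step.IH show ?case by (meson converse_rtranclp_into_rtranclp)
qed simp

lemma conn_trans: "conn E a b \<Longrightarrow> conn E b c \<Longrightarrow> conn E a c"
  by (rule rtranclp_trans)

lemma conn_edge: "(a, b) \<in> E \<Longrightarrow> conn E a b"
  by (auto simp: adj_def)

lemma conn_edge': "(a, b) \<in> E \<Longrightarrow> conn E b a"
  by (auto simp: adj_def)

lemma conn_mono: "conn E a b \<Longrightarrow> E \<subseteq> F \<Longrightarrow> conn F a b"
  by (erule rtranclp_mono[THEN predicate2D, rotated]) (auto simp: adj_def)

lemma conn_colour:
  assumes "conn E a b" and "\<And>x y. (x, y) \<in> E \<Longrightarrow> Z x = Z y"
  shows "Z a = Z b"
  using assms(1) by induction (auto simp: adj_def dest: assms(2))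

text \<open>After its last use of the edge, a walk continues from \<open>a\<close> or
  \<open>b\<close> and avoids the edge.\<close>

lemma conn_remove_edge:
  assumes "conn E u v"
  shows "conn (E - {(a, b)}) u v \<or> conn (E - {(a, b)}) a v \<or> conn (E - {(a, b)}) b v"
  using assms
proof induction
  case (step y z)
  show ?case
  proof (cases "adj (E - {(a, b)}) y z")
    case True
    with step.IH show ?thesis by (meson rtranclp.rtrancl_into_rtrancl)
  next
    case False
    with step.hyps have "z = a \<or> z = b" by (auto simp: adj_def)
    then show ?thesis by auto
  qed
qed simp

text \<open>The walk is cut after its last edge outside \<open>W\<close>. This isolates the final
  stretch of a connection that runs entirely outside a par.\<close>

lemma conn_last_exit:
  assumes "conn (W \<union> D) x m"
  shows "conn W x m \<or> (\<exists>a b y. (a, b) \<in> D \<and> (y = a \<or> y = b) \<and> conn W y m)"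
  using assms
proof (induction rule: converse_rtranclp_induct)
  case (step y z)
  show ?case
  proof (cases "adj W y z")
    case True
    with step.IH show ?thesis by (meson converse_rtranclp_into_rtranclp)
  next
    case False
    with step.hyps have "(y, z) \<in> D \<or> (z, y) \<in> D" by (auto simp: adj_def)
    with step.IH show ?thesis by blast
  qed
qed simp

text \<open>Here \<open>x\<close> is a node whose switch is turned and \<open>c\<close> the child it
  loses. Cut the walk at the lost edge from both ends: if neither \<open>q\<close> nor
  \<open>m\<close> reaches \<open>x\<close>, both still reach \<open>c\<close>, hence each
  other.\<close>

lemma conn_switch_one:
  assumes qm: "conn E q m" and keep: "E - {(x, c)} \<subseteq> F"
  shows "conn F q m \<or> conn F m x \<or> conn F q x"
proof -
  let ?E = "E - {(x, c)}"
  from conn_remove_edge[OF qm, of x c] conn_remove_edge[OF conn_sym[OF qm], of x c]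
  have "conn ?E q m \<or> conn ?E x m \<or> conn ?E x q \<or> (conn ?E c m \<and> conn ?E c q)"
    using conn_sym[of ?E m q] by blast
  then have "conn ?E q m \<or> conn ?E m x \<or> conn ?E q x"
    using conn_sym[of ?E x m] conn_sym[of ?E x q] conn_trans[OF conn_sym[of ?E c q], of m] by blast
  then show ?thesis using keep conn_mono by blast
qed

text \<open>Walk along the connection from n to v, turning the switches it needs; as soon as this
  destroys the connection between q and m, the walk has run into it.\<close>

lemma switching_merge:
  fixes E :: "(node \<Rightarrow> bool) \<Rightarrow> (node \<times> node) set"
  assumes loc: "\<And>s s' x y. (x, y) \<in> E s \<Longrightarrow> s x = s' x \<Longrightarrow> (x, y) \<in> E s'"
    and uniq: "\<And>s s' x y y'. (x, y) \<in> E s \<Longrightarrow> (x, y) \<notin> E s' \<Longrightarrow> (x, y') \<in> E s \<Longrightarrow> y' = y"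
    and qm: "conn (E s1) q m" and nv: "conn (E s2) n v"
  shows "\<exists>s. conn (E s) n m \<or> conn (E s) n q \<or> (conn (E s) q m \<and> conn (E s) n v)"
proof -
  \<comment> \<open>The invariant keeps the walk from \<open>n\<close> inside both switchings:
    turning a switch to its value in \<open>s2\<close> never loses an edge that \<open>s2\<close>
    has.\<close>
  have "\<exists>s. conn (E s) n m \<or> conn (E s) n q \<or> (conn (E s) q m \<and> conn (E s \<inter> E s2) n v)"
    using nv
  proof induction
    case base
    then show ?case using qm by blast
  next
    case (step y z)
    from step.IH obtain s where
      s: "conn (E s) n m \<or> conn (E s) n q \<or> (conn (E s) q m \<and> conn (E s \<inter> E s2) n y)" by blast
    show ?case
    proof (cases "conn (E s) n m \<or> conn (E s) n q")
      case True
      then show ?thesis by blast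
    next
      case False
      with s have qm': "conn (E s) q m" and ny: "conn (E s \<inter> E s2) n y" by auto
      from step.hyps obtain a b where ab: "(a, b) \<in> E s2" "(a = y \<and> b = z) \<or> (a = z \<and> b = y)"
        by (auto simp: adj_def)
      define s' where "s' = s(a := s2 a)"
      have ab': "(a, b) \<in> E s'" using loc[OF ab(1)] by (simp add: s'_def)
      have "E s \<inter> E s2 \<subseteq> E s'"
      proof clarify
        fix u w assume "(u, w) \<in> E s" "(u, w) \<in> E s2"
        then show "(u, w) \<in> E s'"
          using loc[of u w s s'] loc[of u w s2 s'] by (cases "u = a") (auto simp: s'_def)
      qed
      then have "conn (E s' \<inter> E s2) n y" by (intro conn_mono[OF ny]) auto
      moreover have "adj (E s' \<inter> E s2) y z" using ab ab' by (auto simp: adj_def)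
      ultimately have nz: "conn (E s' \<inter> E s2) n z" and ny': "conn (E s' \<inter> E s2) n y" by auto
      then have na: "conn (E s') n a" using ab(2) by (metis conn_mono inf_le1)
      \<comment> \<open>Turning the switch of \<open>a\<close> loses at most one edge, the one to
        its old child. If this breaks the connection between \<open>q\<close> and \<open>m\<close>,
        one of them reaches \<open>a\<close>, and so does \<open>n\<close> by
        \<open>na\<close>.\<close>
      have "conn (E s') q m \<or> conn (E s') m a \<or> conn (E s') q a"
      proof -
        have src: "u = a" if "(u, w) \<in> E s" "(u, w) \<notin> E s'" for u w
          using loc[of u w s s'] that by (cases "u = a") (auto simp: s'_def)
        have "\<exists>c. E s - {(a, c)} \<subseteq> E s'"
        proof (cases "E s \<subseteq> E s'")
          case False
          then obtain u c where "(u, c) \<in> E s" "(u, c) \<notin> E s'" by auto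
          with src have "(a, c) \<in> E s" "(a, c) \<notin> E s'" by auto
          have "(u, w) \<in> E s'" if "(u, w) \<in> E s" "(u, w) \<noteq> (a, c)" for u w
            using src[of u w] uniq[OF \<open>(a, c) \<in> E s\<close> \<open>(a, c) \<notin> E s'\<close>, of w] that by fast
          then have "E s - {(a, c)} \<subseteq> E s'" by auto
          then show ?thesis ..
        qed auto
        then obtain c where "E s - {(a, c)} \<subseteq> E s'" ..
        then show ?thesis by (rule conn_switch_one[OF qm'])
      qed
      then consider "conn (E s') q m" | "conn (E s') a m" | "conn (E s') a q"
        using conn_sym by blast
      then show ?thesis
      proof cases
        case 1
        then show ?thesis using nz by blast
      next
        case 2
        from conn_trans[OF na this] show ?thesis by blast
      next
        case 3
        from conn_trans[OF na this] show ?thesis by blast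
      qed
    qed
  qed
  then show ?thesis by (meson conn_mono inf_le1)
qed

section \<open>Bridges and edge counts of connected acyclic graphs\<close>

lemma conn_simple_path:
  assumes "conn E a b"
  shows "\<exists>vs. vs \<noteq> [] \<and> hd vs = a \<and> last vs = b \<and> distinct vs \<and>
    (\<forall>i. Suc i < length vs \<longrightarrow> adj E (vs ! i) (vs ! Suc i))"
  using assms
proof induction
  case base
  show ?case by (rule exI[of _ "[a]"]) simp
next
  case (step y z)
  then obtain vs where vs: "vs \<noteq> []" "hd vs = a" "last vs = y" "distinct vs"
    "\<forall>i. Suc i < length vs \<longrightarrow> adj E (vs ! i) (vs ! Suc i)" by blast
  show ?case
  proof (cases "z \<in> set vs")
    case True
    then obtain k where k: "k < length vs" "vs ! k = z" by (auto simp: in_set_conv_nth)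
    have "last (take (Suc k) vs) = z" using k by (simp add: take_Suc_conv_app_nth)
    moreover have "hd (take (Suc k) vs) = a" using vs by simp
    ultimately show ?thesis using vs k by (intro exI[of _ "take (Suc k) vs"]) auto
  next
    case False
    have "adj E ((vs @ [z]) ! i) ((vs @ [z]) ! Suc i)" if "Suc i < length (vs @ [z])" for i
    proof (cases "Suc i < length vs")
      case True
      then show ?thesis using vs(5) by (simp add: nth_append)
    next
      case False
      with that have "i = length vs - 1" "Suc i = length vs" by auto
      then show ?thesis using step.hyps(2) vs(1,3) by (simp add: nth_append last_conv_nth)
    qed
    then show ?thesis using vs False by (intro exI[of _ "vs @ [z]"]) auto
  qed
qed

text \<open>A detour around the edge would close a cycle. The last two premises ensure that the
  cycle has at least three nodes, as \<open>acyclic_on\<close> ignores shorter ones.\<close>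

lemma acyclic_bridge:
  assumes "acyclic_on E" and "(a, b) \<in> E" and "a \<noteq> b" and "(b, a) \<notin> E"
  shows "\<not> conn (E - {(a, b)}) a b"
proof
  assume "conn (E - {(a, b)}) a b"
  then obtain vs where vs: "vs \<noteq> []" "hd vs = a" "last vs = b" "distinct vs"
    "\<forall>i. Suc i < length vs \<longrightarrow> adj (E - {(a, b)}) (vs ! i) (vs ! Suc i)"
    using conn_simple_path by blast
  have "length vs \<noteq> 1" using vs assms(3) by (auto simp: length_Suc_conv)
  moreover have "length vs \<noteq> 2"
  proof
    assume "length vs = 2"
    then have "adj (E - {(a, b)}) a b" using vs
      by (auto simp: hd_conv_nth last_conv_nth numeral_2_eq_2)
    then show False using assms(4) by (auto simp: adj_def)
  qed
  moreover have "length vs \<noteq> 0" using vs(1) by simp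
  ultimately have "3 \<le> length vs" by linarith
  moreover have "\<forall>i. Suc i < length vs \<longrightarrow> adj E (vs ! i) (vs ! Suc i)"
    using vs(5) by (auto simp: adj_def)
  moreover have "adj E (last vs) (hd vs)" using vs assms(2) by (auto simp: adj_def)
  ultimately show False using assms(1) vs(4) unfolding acyclic_on_def by blast
qed

text \<open>Map each edge to its endpoint away from the root r.\<close>

lemma card_edges_le:
  assumes "finite V" and E: "E \<subseteq> V \<times> V" and r: "r \<in> V" and co: "connected_on V E"
    and bridge: "\<And>a b. (a, b) \<in> E \<Longrightarrow> \<not> conn (E - {(a, b)}) a b"
  shows "card E \<le> card (V - {r})"
proof -
  define far where "far e = (if conn (E - {e}) r (fst e) then snd e else fst e)" for e
  define near where "near e = (if conn (E - {e}) r (fst e) then fst e else snd e)" for e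
  have far: "\<not> conn (E - {e}) r (far e)" and near: "conn (E - {e}) r (near e)" if "e \<in> E" for e
  proof -
    obtain a b where e: "e = (a, b)" by (cases e)
    have nb: "\<not> conn (E - {(a, b)}) a b" using bridge that e by blast
    have "conn E a r" using co E that r e by (auto simp: connected_on_def)
    from conn_remove_edge[OF this, of a b] have "conn (E - {(a, b)}) a r \<or> conn (E - {(a, b)}) b r"
      by blast
    then have "conn (E - {(a, b)}) r a \<or> conn (E - {(a, b)}) r b" by (blast intro: conn_sym)
    moreover have "\<not> (conn (E - {(a, b)}) r a \<and> conn (E - {(a, b)}) r b)"
      using nb by (meson conn_sym conn_trans)
    ultimately show "\<not> conn (E - {e}) r (far e)" "conn (E - {e}) r (near e)"
      by (auto simp: far_def near_def e)
  qed
  have "inj_on far E"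
  proof (rule inj_onI, rule ccontr)
    fix e e' assume e: "e \<in> E" "e' \<in> E" "far e = far e'" "e \<noteq> e'"
    have inc: "far e' = fst e' \<or> far e' = snd e'" by (simp add: far_def)
    \<comment> \<open>A walk from \<open>r\<close> that avoids \<open>e\<close> never visits
      \<open>far e\<close>. As \<open>e'\<close> ends there too, the walk also avoids
      \<open>e'\<close>; appending \<open>e\<close> then reaches \<open>far e'\<close> without
      \<open>e'\<close>.\<close>
    have "conn (E - {e} - {e'}) r (near e)"
      using near[OF e(1)]
    proof induction
      case (step y z)
      have "conn (E - {e}) r z" using step.hyps by (rule rtranclp.rtrancl_into_rtrancl)
      then have "y \<noteq> far e" "z \<noteq> far e" using far[OF e(1)] step.hyps(1) by auto
      then have "(y, z) \<noteq> e'" "(z, y) \<noteq> e'" using inc e(3) by auto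
      then have "adj (E - {e} - {e'}) y z" using step.hyps(2) by (auto simp: adj_def)
      with step.IH show ?case by (rule rtranclp.rtrancl_into_rtrancl)
    qed simp
    then have "conn (E - {e'}) r (near e)" by (rule conn_mono) auto
    moreover have "adj (E - {e'}) (near e) (far e)"
      using e by (cases e) (auto simp: adj_def near_def far_def)
    ultimately have "conn (E - {e'}) r (far e)" by (rule rtranclp.rtrancl_into_rtrancl)
    then show False using far[OF e(2)] e(3) by simp
  qed
  moreover have "far ` E \<subseteq> V - {r}"
  proof clarify
    fix a b assume ab: "(a, b) \<in> E"
    have "far (a, b) \<in> V" using ab E by (auto simp: far_def)
    moreover have "far (a, b) \<noteq> r" using far[OF ab] by auto
    ultimately show "far (a, b) \<in> V - {r}" by simp
  qed
  ultimately show ?thesis using \<open>finite V\<close> by (meson card_inj_on_le finite_Diff)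
qed

text \<open>Map each node other than the root r to the first edge of a shortest path to r.\<close>

lemma card_edges_ge:
  assumes "finite E" and r: "r \<in> V" and co: "connected_on V E"
  shows "card (V - {r}) \<le> card E"
proof -
  define d where "d v = (LEAST n. ((adj E) ^^ n) r v)" for v
  have ex: "\<exists>e. e \<in> E \<and> (\<exists>u. (e = (u, v) \<or> e = (v, u)) \<and> d v = Suc (d u))" if "v \<in> V - {r}" for v
  proof -
    have "conn E r v" using co r that by (auto simp: connected_on_def)
    then have "\<exists>n. ((adj E) ^^ n) r v" by (simp add: rtranclp_is_Sup_relpowp)
    then have dv: "((adj E) ^^ d v) r v" unfolding d_def by (rule LeastI_ex)
    moreover have "d v \<noteq> 0" using dv that by (metis Diff_iff relpowp_0_E singletonI)
    ultimately obtain n where n: "d v = Suc n" by (cases "d v") auto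
    with dv obtain u where u: "((adj E) ^^ n) r u" "adj E u v" by auto
    have du: "((adj E) ^^ d u) r u" unfolding d_def by (rule LeastI) (rule u(1))
    have "d u \<le> n" unfolding d_def by (rule Least_le) (rule u(1))
    moreover have "((adj E) ^^ Suc (d u)) r v" using du u(2) by auto
    then have "d v \<le> Suc (d u)" unfolding d_def[of v] by (rule Least_le)
    ultimately have "d v = Suc (d u)" using n by simp
    with u(2) show ?thesis by (auto simp: adj_def)
  qed
  then obtain f where f: "\<And>v. v \<in> V - {r} \<Longrightarrow>
      f v \<in> E \<and> (\<exists>u. (f v = (u, v) \<or> f v = (v, u)) \<and> d v = Suc (d u))"
    by metis
  \<comment> \<open>The distance \<open>d\<close> orients the edge: \<open>v\<close> is the end of
    \<open>f v\<close> farther from \<open>r\<close>, so the edge determines it.\<close>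
  have "inj_on f (V - {r})"
  proof (rule inj_onI)
    fix v v' assume v: "v \<in> V - {r}" "v' \<in> V - {r}" "f v = f v'"
    from f[OF v(1)] obtain u where "f v = (u, v) \<or> f v = (v, u)" "d v = Suc (d u)" by blast
    moreover from f[OF v(2)] obtain u' where "f v' = (u', v') \<or> f v' = (v', u')" "d v' = Suc (d u')"
      by blast
    ultimately show "v = v'" using v(3) by auto
  qed
  moreover have "f ` (V - {r}) \<subseteq> E" using f by blast
  ultimately show ?thesis using \<open>finite E\<close> by (meson card_inj_on_le)
qed

lemma conn_nth:
  assumes "\<forall>i. Suc i < length vs \<longrightarrow> adj E (vs ! i) (vs ! Suc i)" and "j < length vs"
  shows "conn E (vs ! 0) (vs ! j)"
  using assms(2)
proof (induction j)
  case (Suc j)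
  then show ?case using assms(1) by (meson Suc_lessD rtranclp.rtrancl_into_rtrancl)
qed simp

text \<open>Deleting the closing edge of a cycle keeps the graph connected, but leaves fewer edges
  than a connected graph on \<open>V\<close> must have.\<close>

lemma connected_acyclic:
  assumes "finite E" and r: "r \<in> V" and co: "connected_on V E" and le: "card E \<le> card (V - {r})"
  shows "acyclic_on E"
  unfolding acyclic_on_def
proof clarify
  fix vs assume len: "3 \<le> length vs" and dist: "distinct vs"
    and path: "\<forall>i. Suc i < length vs \<longrightarrow> adj E (vs ! i) (vs ! Suc i)"
    and close: "adj E (last vs) (hd vs)"
  define x where "x = vs ! (length vs - 1)"
  define y where "y = vs ! 0"
  have xy: "last vs = x" "hd vs = y"
    using len by (cases vs; simp add: x_def y_def last_conv_nth)+
  have ne: "0 < length vs" using len by linarith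
  \<comment> \<open>Both orientations are removed, because \<open>adj\<close> ignores direction and
    either pair may be the closing edge.\<close>
  define F where "F = E - {(x, y), (y, x)}"
  have "adj F (vs ! i) (vs ! Suc i)" if i: "Suc i < length vs" for i
  proof -
    have "vs ! i = x \<longleftrightarrow> i = length vs - 1" "vs ! Suc i = x \<longleftrightarrow> Suc i = length vs - 1"
      "vs ! i = y \<longleftrightarrow> i = 0" "vs ! Suc i \<noteq> y"
      unfolding x_def y_def using i ne by (subst nth_eq_iff_index_eq[OF dist]; simp)+
    then have "\<not> (vs ! i = x \<and> vs ! Suc i = y)" "\<not> (vs ! i = y \<and> vs ! Suc i = x)"
      using len by auto
    then show ?thesis using path i by (auto simp: adj_def F_def)
  qed
  then have yx: "conn F y x" unfolding x_def y_def using len by (intro conn_nth) auto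
  have "conn F a b" if "conn E a b" for a b
    using that
  proof induction
    case (step u w)
    have "conn F u w"
    proof (cases "adj F u w")
      case False
      with step.hyps(2) have "(u = x \<and> w = y) \<or> (u = y \<and> w = x)" by (auto simp: adj_def F_def)
      then show ?thesis using yx conn_sym by blast
    qed auto
    with step.IH show ?case by (rule conn_trans)
  qed simp
  then have "connected_on V F" using co by (auto simp: connected_on_def)
  then have "card (V - {r}) \<le> card F" using assms(1) r by (intro card_edges_ge) (auto simp: F_def)
  moreover have "card F < card E"
    using close \<open>finite E\<close> unfolding xy F_def adj_def by (intro psubset_card_mono) auto
  ultimately show False using le by simp
qed

section \<open>Switchings of trees\<close>

text \<open>Used to tell the edges of the linking from those of the sequent, to exclude loops and
  opposite edges, and to see that a node below a position can only be entered from a node at or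
  below that position.\<close>

lemma swedges_shape:
  "(a, b) \<in> swedges s mk p T \<Longrightarrow>
    \<exists>w. a = mk (p @ w) \<and> ((\<exists>x. b = mk (p @ w @ [x])) \<or> (\<exists>l\<in>set (leaves T). b = NLeaf (fst l)))"
proof (induction T arbitrary: p)
  case (Tens A B)
  have r: "\<exists>x. rnode mk (p @ [y]) C = mk (p @ [x]) \<or> (\<exists>l\<in>set (leaves C). rnode mk (p @ [y]) C = NLeaf (fst l))"
    for C y by (cases C) auto
  from Tens.prems consider "(a, b) = (mk p, rnode mk (p @ [False]) A)"
    | "(a, b) = (mk p, rnode mk (p @ [True]) B)"
    | "(a, b) \<in> swedges s mk (p @ [False]) A" | "(a, b) \<in> swedges s mk (p @ [True]) B" by auto
  then show ?case
  proof cases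
    case 1 then show ?thesis using r[of False A] by (intro exI[of _ "[]"]) auto
  next
    case 2 then show ?thesis using r[of True B] by (intro exI[of _ "[]"]) auto
  next
    case 3
    from Tens.IH(1)[OF this] obtain w where "a = mk (p @ False # w)"
      "(\<exists>x. b = mk (p @ (False # w) @ [x])) \<or> (\<exists>l\<in>set (leaves (Tens A B)). b = NLeaf (fst l))" by auto
    then show ?thesis by blast
  next
    case 4
    from Tens.IH(2)[OF this] obtain w where "a = mk (p @ True # w)"
      "(\<exists>x. b = mk (p @ (True # w) @ [x])) \<or> (\<exists>l\<in>set (leaves (Tens A B)). b = NLeaf (fst l))" by auto
    then show ?thesis by blast
  qed
next
  case (Par A B)
  have r: "\<exists>x. rnode mk (p @ [y]) C = mk (p @ [x]) \<or> (\<exists>l\<in>set (leaves C). rnode mk (p @ [y]) C = NLeaf (fst l))"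
    for C y by (cases C) auto
  from Par.prems consider "(a, b) = (mk p, rnode mk (p @ [False]) A)"
    | "(a, b) = (mk p, rnode mk (p @ [True]) B)"
    | "(a, b) \<in> swedges s mk (p @ [False]) A" | "(a, b) \<in> swedges s mk (p @ [True]) B"
    by (auto split: if_splits)
  then show ?case
  proof cases
    case 1 then show ?thesis using r[of False A] by (intro exI[of _ "[]"]) auto
  next
    case 2 then show ?thesis using r[of True B] by (intro exI[of _ "[]"]) auto
  next
    case 3
    from Par.IH(1)[OF this] obtain w where "a = mk (p @ False # w)"
      "(\<exists>x. b = mk (p @ (False # w) @ [x])) \<or> (\<exists>l\<in>set (leaves (Par A B)). b = NLeaf (fst l))" by auto
    then show ?thesis by blast
  next
    case 4
    from Par.IH(2)[OF this] obtain w where "a = mk (p @ True # w)"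
      "(\<exists>x. b = mk (p @ (True # w) @ [x])) \<or> (\<exists>l\<in>set (leaves (Par A B)). b = NLeaf (fst l))" by auto
    then show ?thesis by blast
  qed
qed simp

lemma swedges_source: "(a, b) \<in> swedges s mk p T \<Longrightarrow> \<exists>w. a = mk (p @ w)"
  using swedges_shape by blast

lemma swedges_local: "(a, b) \<in> swedges s mk p T \<Longrightarrow> s a = s' a \<Longrightarrow> (a, b) \<in> swedges s' mk p T"
  by (induction T arbitrary: p) (auto split: if_splits)

text \<open>An edge that disappears in another switching starts at a par, since a tensor keeps both
  edges; and a par keeps only one edge per switching. Injectivity of \<open>mk\<close> keeps the
  sources in the two subtrees apart. This supplies a premise of
  \<open>switching_merge\<close>.\<close>

lemma swedges_uniq:
  assumes "inj mk"
  shows "(a, b) \<in> swedges s mk p T \<Longrightarrow> (a, b) \<notin> swedges s' mk p T \<Longrightarrow> (a, b') \<in> swedges s mk p T \<Longrightarrow> b' = b"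
proof (induction T arbitrary: p)
  case (Tens A B)
  have "a \<noteq> mk p" using Tens.prems(1,2) by (auto simp: inj_eq[OF assms] dest!: swedges_source)
  moreover have "\<not> ((a, u) \<in> swedges s mk (p @ [False]) A \<and> (a, v) \<in> swedges s mk (p @ [True]) B)" for u v
    by (auto simp: inj_eq[OF assms] dest!: swedges_source)
  ultimately show ?case using Tens by auto
next
  case (Par A B)
  have 1: "\<not> ((a, u) \<in> swedges s mk (p @ [False]) A \<and> (a, v) \<in> swedges s mk (p @ [True]) B)" for u v
    by (auto simp: inj_eq[OF assms] dest!: swedges_source)
  show ?case
  proof (cases "a = mk p")
    case True
    have "(a, u) \<notin> swedges s mk (p @ [False]) A" "(a, u) \<notin> swedges s mk (p @ [True]) B" for u
      using True by (auto simp: inj_eq[OF assms] dest!: swedges_source)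
    then show ?thesis using Par.prems True by (auto split: if_splits)
  next
    case False
    then show ?thesis using Par 1 by (auto split: if_splits)
  qed
qed simp

lemma finite_swedges: "finite (swedges s mk p T)"
  by (induction T arbitrary: p) auto

lemma finite_tnodes: "finite (tnodes mk p T)"
  by (induction T arbitrary: p) auto

lemma rnode_in_tnodes: "rnode mk p T \<in> tnodes mk p T"
  by (cases T) auto

lemma swedges_tnodes: "swedges s mk p T \<subseteq> tnodes mk p T \<times> tnodes mk p T"
  by (induction T arbitrary: p) (auto simp: rnode_in_tnodes)

lemma leaf_in_tnodes: "l \<in> set (leaves T) \<Longrightarrow> NLeaf (fst l) \<in> tnodes mk p T"
  by (induction T arbitrary: p) auto

lemma tnodes_shape:
  "x \<in> tnodes mk p T \<Longrightarrow> (\<exists>w. x = mk (p @ w)) \<or> (\<exists>l\<in>set (leaves T). x = NLeaf (fst l))"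
proof (induction T arbitrary: p)
  case (Tens A B)
  from Tens.prems consider "\<exists>w. x = mk (p @ w)" | "x \<in> tnodes mk (p @ [False]) A"
    | "x \<in> tnodes mk (p @ [True]) B" by simp (metis append_Nil2)
  then show ?case
    using Tens.IH(1)[of "p @ [False]"] Tens.IH(2)[of "p @ [True]"] by cases auto
next
  case (Par A B)
  from Par.prems consider "\<exists>w. x = mk (p @ w)" | "x \<in> tnodes mk (p @ [False]) A"
    | "x \<in> tnodes mk (p @ [True]) B" by simp (metis append_Nil2)
  then show ?case
    using Par.IH(1)[of "p @ [False]"] Par.IH(2)[of "p @ [True]"] by cases auto
qed simp

text \<open>Every inner node keeps an edge to at least one child, so one can descend to a leaf in
  any switching. Connectedness of a graph can therefore be tested on leaves.\<close>

lemma node_conn_leaf: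
  "x \<in> tnodes mk p T \<Longrightarrow> \<exists>l\<in>set (leaves T). conn (swedges s mk p T) x (NLeaf (fst l))"
proof (induction T arbitrary: p x)
  case (Tens A B)
  have up: "conn (swedges s mk p (Tens A B)) u v" if "conn (swedges s mk (p @ [False]) A) u v" for u v
    using that by (rule conn_mono) auto
  have up': "conn (swedges s mk p (Tens A B)) u v" if "conn (swedges s mk (p @ [True]) B) u v" for u v
    using that by (rule conn_mono) auto
  from Tens.IH(1)[OF rnode_in_tnodes] obtain l where l: "l \<in> set (leaves A)"
    "conn (swedges s mk (p @ [False]) A) (rnode mk (p @ [False]) A) (NLeaf (fst l))" by blast
  have "conn (swedges s mk p (Tens A B)) (mk p) (rnode mk (p @ [False]) A)"
    by (rule conn_edge) simp
  from conn_trans[OF this up[OF l(2)]]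
  have root: "\<exists>l\<in>set (leaves (Tens A B)). conn (swedges s mk p (Tens A B)) (mk p) (NLeaf (fst l))"
    using l(1) by auto
  consider "x = mk p" | "x \<in> tnodes mk (p @ [False]) A" | "x \<in> tnodes mk (p @ [True]) B"
    using Tens.prems by auto
  then show ?case
  proof cases
    case 1 then show ?thesis using root by simp
  next
    case 2 from Tens.IH(1)[OF this] show ?thesis using up by (metis Un_iff leaves.simps(2) set_append)
  next
    case 3 from Tens.IH(2)[OF this] show ?thesis using up' by (metis Un_iff leaves.simps(2) set_append)
  qed
next
  case (Par A B)
  have up: "conn (swedges s mk p (Par A B)) u v" if "conn (swedges s mk (p @ [False]) A) u v" for u v
    using that by (rule conn_mono) auto
  have up': "conn (swedges s mk p (Par A B)) u v" if "conn (swedges s mk (p @ [True]) B) u v" for u v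
    using that by (rule conn_mono) auto
  have root: "\<exists>l\<in>set (leaves (Par A B)). conn (swedges s mk p (Par A B)) (mk p) (NLeaf (fst l))"
  proof (cases "s (mk p)")
    case True
    from Par.IH(2)[OF rnode_in_tnodes] obtain l where l: "l \<in> set (leaves B)"
      "conn (swedges s mk (p @ [True]) B) (rnode mk (p @ [True]) B) (NLeaf (fst l))" by blast
    have "conn (swedges s mk p (Par A B)) (mk p) (rnode mk (p @ [True]) B)"
      by (rule conn_edge) (simp add: True)
    from conn_trans[OF this up'[OF l(2)]] show ?thesis using l(1) by auto
  next
    case False
    from Par.IH(1)[OF rnode_in_tnodes] obtain l where l: "l \<in> set (leaves A)"
      "conn (swedges s mk (p @ [False]) A) (rnode mk (p @ [False]) A) (NLeaf (fst l))" by blast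
    have "conn (swedges s mk p (Par A B)) (mk p) (rnode mk (p @ [False]) A)"
      by (rule conn_edge) (simp add: False)
    from conn_trans[OF this up[OF l(2)]] show ?thesis using l(1) by auto
  qed
  consider "x = mk p" | "x \<in> tnodes mk (p @ [False]) A" | "x \<in> tnodes mk (p @ [True]) B"
    using Par.prems by auto
  then show ?case
  proof cases
    case 1 then show ?thesis using root by simp
  next
    case 2 from Par.IH(1)[OF this] show ?thesis using up by (metis Un_iff leaves.simps(3) set_append)
  next
    case 3 from Par.IH(2)[OF this] show ?thesis using up' by (metis Un_iff leaves.simps(3) set_append)
  qed
qed auto

text \<open>Switchings relative to the root of a subtree are glued along the first step of the path.\<close>

definition glue :: "'a \<Rightarrow> (bool list \<Rightarrow> 'a) \<Rightarrow> (bool list \<Rightarrow> 'a) \<Rightarrow> bool list \<Rightarrow> 'a" where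
  "glue c f g w = (case w of [] \<Rightarrow> c | b # v \<Rightarrow> if b then g v else f v)"

lemma glue_simps [simp]: "glue c f g [] = c" "glue c f g (False # w) = f w" "glue c f g (True # w) = g w"
  by (simp_all add: glue_def)

text \<open>Each par on the way is switched to the child that contains \<open>l\<close>. The
  switches \<open>\<sigma>\<close> are relative to the root and fixed before \<open>s\<close> and
  \<open>p\<close>, so they can be transplanted to any position and glued with other
  choices.\<close>

lemma switch_to_leaf:
  assumes "l \<in> set (leaves T)"
  shows "\<exists>\<sigma>. \<forall>s p. (\<forall>w. s (mk (p @ w)) = \<sigma> w) \<longrightarrow>
    conn (swedges s mk p T) (rnode mk p T) (NLeaf (fst l))"
  using assms
proof (induction T)
  case (Tens A B)
  show ?case
  proof (cases "l \<in> set (leaves A)")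
    case True
    from Tens.IH(1)[OF True] obtain \<sigma> where
      \<sigma>: "\<forall>s p. (\<forall>w. s (mk (p @ w)) = \<sigma> w) \<longrightarrow> conn (swedges s mk p A) (rnode mk p A) (NLeaf (fst l))" by blast
    show ?thesis
    \<comment> \<open>The value at the tensor root and the second \<open>\<sigma>\<close>, used off
      the way to \<open>l\<close>, are arbitrary.\<close>
    proof (intro exI[of _ "glue True \<sigma> \<sigma>"] allI impI)
      fix s p assume s: "\<forall>w. s (mk (p @ w)) = glue True \<sigma> \<sigma> w"
      have "\<forall>w. s (mk ((p @ [False]) @ w)) = \<sigma> w" using s by simp
      then have "conn (swedges s mk (p @ [False]) A) (rnode mk (p @ [False]) A) (NLeaf (fst l))" using \<sigma> by blast
      then have "conn (swedges s mk p (Tens A B)) (rnode mk (p @ [False]) A) (NLeaf (fst l))"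
        by (rule conn_mono) auto
      then show "conn (swedges s mk p (Tens A B)) (rnode mk p (Tens A B)) (NLeaf (fst l))"
        by (rule conn_trans[rotated]) (rule conn_edge, simp)
    qed
  next
    case False
    then have "l \<in> set (leaves B)" using Tens.prems by simp
    from Tens.IH(2)[OF this] obtain \<sigma> where
      \<sigma>: "\<forall>s p. (\<forall>w. s (mk (p @ w)) = \<sigma> w) \<longrightarrow> conn (swedges s mk p B) (rnode mk p B) (NLeaf (fst l))" by blast
    show ?thesis
    proof (intro exI[of _ "glue True \<sigma> \<sigma>"] allI impI)
      fix s p assume s: "\<forall>w. s (mk (p @ w)) = glue True \<sigma> \<sigma> w"
      have "\<forall>w. s (mk ((p @ [True]) @ w)) = \<sigma> w" using s by simp
      then have "conn (swedges s mk (p @ [True]) B) (rnode mk (p @ [True]) B) (NLeaf (fst l))" using \<sigma> by blast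
      then have "conn (swedges s mk p (Tens A B)) (rnode mk (p @ [True]) B) (NLeaf (fst l))"
        by (rule conn_mono) auto
      then show "conn (swedges s mk p (Tens A B)) (rnode mk p (Tens A B)) (NLeaf (fst l))"
        by (rule conn_trans[rotated]) (rule conn_edge, simp)
    qed
  qed
next
  case (Par A B)
  show ?case
  proof (cases "l \<in> set (leaves A)")
    case True
    from Par.IH(1)[OF True] obtain \<sigma> where
      \<sigma>: "\<forall>s p. (\<forall>w. s (mk (p @ w)) = \<sigma> w) \<longrightarrow> conn (swedges s mk p A) (rnode mk p A) (NLeaf (fst l))" by blast
    show ?thesis
    proof (intro exI[of _ "glue False \<sigma> \<sigma>"] allI impI)
      fix s p assume s: "\<forall>w. s (mk (p @ w)) = glue False \<sigma> \<sigma> w"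
      have "\<forall>w. s (mk ((p @ [False]) @ w)) = \<sigma> w" using s by simp
      then have "conn (swedges s mk (p @ [False]) A) (rnode mk (p @ [False]) A) (NLeaf (fst l))" using \<sigma> by blast
      then have "conn (swedges s mk p (Par A B)) (rnode mk (p @ [False]) A) (NLeaf (fst l))"
        by (rule conn_mono) auto
      moreover have "s (mk p) = False" using spec[OF s, of "[]"] by simp
      then have "conn (swedges s mk p (Par A B)) (mk p) (rnode mk (p @ [False]) A)"
        by (intro conn_edge) simp
      ultimately show "conn (swedges s mk p (Par A B)) (rnode mk p (Par A B)) (NLeaf (fst l))"
        by (metis conn_trans rnode.simps(3))
    qed
  next
    case False
    then have "l \<in> set (leaves B)" using Par.prems by simp
    from Par.IH(2)[OF this] obtain \<sigma> where
      \<sigma>: "\<forall>s p. (\<forall>w. s (mk (p @ w)) = \<sigma> w) \<longrightarrow> conn (swedges s mk p B) (rnode mk p B) (NLeaf (fst l))" by blast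
    show ?thesis
    proof (intro exI[of _ "glue True \<sigma> \<sigma>"] allI impI)
      fix s p assume s: "\<forall>w. s (mk (p @ w)) = glue True \<sigma> \<sigma> w"
      have "\<forall>w. s (mk ((p @ [True]) @ w)) = \<sigma> w" using s by simp
      then have "conn (swedges s mk (p @ [True]) B) (rnode mk (p @ [True]) B) (NLeaf (fst l))" using \<sigma> by blast
      then have "conn (swedges s mk p (Par A B)) (rnode mk (p @ [True]) B) (NLeaf (fst l))"
        by (rule conn_mono) auto
      moreover have "s (mk p) = True" using spec[OF s, of "[]"] by simp
      then have "conn (swedges s mk p (Par A B)) (mk p) (rnode mk (p @ [True]) B)"
        by (intro conn_edge) simp
      ultimately show "conn (swedges s mk p (Par A B)) (rnode mk p (Par A B)) (NLeaf (fst l))"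
        by (metis conn_trans rnode.simps(3))
    qed
  qed
qed simp

section \<open>Edges inside and outside a position of a tree\<close>

fun is_leaf :: "tree \<Rightarrow> bool" where
  "is_leaf (Leaf l) = True"
| "is_leaf (Tens A B) = False"
| "is_leaf (Par A B) = False"

lemma rnode_inner: "\<not> is_leaf T \<Longrightarrow> rnode mk p T = mk p"
  by (cases T) auto

lemma subtree_at_append:
  "subtree_at T p = Some X \<Longrightarrow> subtree_at T (p @ q) = subtree_at X q"
  by (induction T p rule: subtree_at.induct) auto

lemma subtree_at_replace:
  "subtree_at T p = Some X \<Longrightarrow> subtree_at (replace_at T p Y) p = Some Y"
  by (induction T p rule: subtree_at.induct) auto

lemma replace_at_append:
  "subtree_at T p = Some X \<Longrightarrow> replace_at T (p @ q) Y = replace_at T p (replace_at X q Y)"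
  by (induction T p rule: subtree_at.induct) auto

lemma replace_at_self: "subtree_at T p = Some X \<Longrightarrow> replace_at T p X = T"
  by (induction T p rule: subtree_at.induct) auto

lemma subtree_distinct:
  "subtree_at T p = Some X \<Longrightarrow> distinct (map fst (leaves T)) \<Longrightarrow> distinct (map fst (leaves X))"
  by (induction T p rule: subtree_at.induct) auto

text \<open>An edge belongs to a subtree exactly when its source lies there. Targets would not
  decide this, because leaf nodes carry no path.\<close>

lemma swedges_subtree:
  "subtree_at T q = Some X \<Longrightarrow>
    (a, b) \<in> swedges s NP p T \<and> (\<exists>w. a = NP (p @ q @ w)) \<longleftrightarrow> (a, b) \<in> swedges s NP (p @ q) X"
proof (induction T q arbitrary: p rule: subtree_at.induct)
  case (1 T)
  then show ?case using swedges_source by fastforce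
next
  case (3 A B q)
  have "(a, b) \<notin> swedges s NP (p @ [True]) B" if "a = NP (p @ False # q @ w)" for w
    using swedges_source[of a b s NP "p @ [True]" B] that by auto
  then have "(a, b) \<in> swedges s NP p (Tens A B) \<and> (\<exists>w. a = NP (p @ (False # q) @ w)) \<longleftrightarrow>
      (a, b) \<in> swedges s NP (p @ [False]) A \<and> (\<exists>w. a = NP ((p @ [False]) @ q @ w))"
    by (auto split: if_splits)
  then show ?case using 3(1)[of "p @ [False]"] 3(2) by simp
next
  case (4 A B q)
  have "(a, b) \<notin> swedges s NP (p @ [False]) A" if "a = NP (p @ True # q @ w)" for w
    using swedges_source[of a b s NP "p @ [False]" A] that by auto
  then have "(a, b) \<in> swedges s NP p (Tens A B) \<and> (\<exists>w. a = NP (p @ (True # q) @ w)) \<longleftrightarrow>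
      (a, b) \<in> swedges s NP (p @ [True]) B \<and> (\<exists>w. a = NP ((p @ [True]) @ q @ w))"
    by (auto split: if_splits)
  then show ?case using 4(1)[of "p @ [True]"] 4(2) by simp
next
  case (5 A B q)
  have "(a, b) \<notin> swedges s NP (p @ [True]) B" if "a = NP (p @ False # q @ w)" for w
    using swedges_source[of a b s NP "p @ [True]" B] that by auto
  then have "(a, b) \<in> swedges s NP p (Par A B) \<and> (\<exists>w. a = NP (p @ (False # q) @ w)) \<longleftrightarrow>
      (a, b) \<in> swedges s NP (p @ [False]) A \<and> (\<exists>w. a = NP ((p @ [False]) @ q @ w))"
    by (auto split: if_splits)
  then show ?case using 5(1)[of "p @ [False]"] 5(2) by simp
next
  case (6 A B q)
  have "(a, b) \<notin> swedges s NP (p @ [False]) A" if "a = NP (p @ True # q @ w)" for w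
    using swedges_source[of a b s NP "p @ [False]" A] that by auto
  then have "(a, b) \<in> swedges s NP p (Par A B) \<and> (\<exists>w. a = NP (p @ (True # q) @ w)) \<longleftrightarrow>
      (a, b) \<in> swedges s NP (p @ [True]) B \<and> (\<exists>w. a = NP ((p @ [True]) @ q @ w))"
    by (auto split: if_splits)
  then show ?case using 6(1)[of "p @ [True]"] 6(2) by simp
qed simp

text \<open>Exchanging a leaf for an inner node would change the name of the root node, and with it
  the target of the parent's edge; hence the two premises on \<open>is_leaf\<close>.\<close>

lemma rnode_replace:
  "subtree_at T q = Some X \<Longrightarrow> \<not> is_leaf X \<Longrightarrow> \<not> is_leaf Y \<Longrightarrow>
    rnode mk p (replace_at T q Y) = rnode mk p T"
  by (induction T q rule: subtree_at.induct) (auto simp: rnode_inner)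

lemma swedges_replace:
  "subtree_at T q = Some X \<Longrightarrow> \<not> is_leaf X \<Longrightarrow> \<not> is_leaf Y \<Longrightarrow> \<nexists>w. a = NP (p @ q @ w) \<Longrightarrow>
    (a, b) \<in> swedges s NP p (replace_at T q Y) \<longleftrightarrow> (a, b) \<in> swedges s NP p T"
proof (induction T q arbitrary: p rule: subtree_at.induct)
  case (1 T)
  then show ?case using swedges_source by fastforce
next
  case (3 A B q)
  then show ?case using 3(1)[of "p @ [False]"] by (simp add: rnode_replace)
next
  case (4 A B q)
  then show ?case using 4(1)[of "p @ [True]"] by (simp add: rnode_replace)
next
  case (5 A B q)
  then show ?case using 5(1)[of "p @ [False]"] by (simp add: rnode_replace)
next
  case (6 A B q)
  then show ?case using 6(1)[of "p @ [True]"] by (simp add: rnode_replace)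
qed simp

section \<open>Connectedness via two-colourings\<close>

text \<open>\<open>col T z c\<close>: some switching of T admits a two-colouring, constant along edges, that
  extends the colouring z of the leaves and gives the root the colour c.\<close>

fun col :: "tree \<Rightarrow> (nat \<Rightarrow> bool) \<Rightarrow> bool \<Rightarrow> bool" where
  "col (Leaf l) z c = (z (fst l) = c)"
| "col (Tens A B) z c = (col A z c \<and> col B z c)"
| "col (Par A B) z c = ((col A z c \<and> (\<exists>c'. col B z c')) \<or> (col B z c \<and> (\<exists>c'. col A z c')))"

fun sel_col :: "sel \<Rightarrow> (nat \<Rightarrow> bool) \<Rightarrow> bool" where
  "sel_col (Form A) z = (\<exists>c. col A z c)"
| "sel_col (Cut A B) z = (\<exists>c. col A z c \<and> col B z c)"

text \<open>The linking and the sequent elements may each choose a switching and a root colour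
  separately: they share only leaves, so the choices combine into one switching of the whole
  graph.\<close>

definition colours_constant :: "tree \<Rightarrow> sel list \<Rightarrow> bool" where
  "colours_constant P \<Gamma> \<longleftrightarrow> (\<forall>z. (\<exists>c. col P z c) \<longrightarrow> (\<forall>x\<in>set \<Gamma>. sel_col x z) \<longrightarrow>
     (\<forall>l\<in>set (leaves P). \<forall>l'\<in>set (leaves P). z (fst l) = z (fst l')))"

lemma col_of_colouring:
  "(\<And>a b. (a, b) \<in> swedges s mk p T \<Longrightarrow> Z a = Z b) \<Longrightarrow> col T (\<lambda>i. Z (NLeaf i)) (Z (rnode mk p T))"
proof (induction T arbitrary: p)
  case (Tens A B)
  have "col A (\<lambda>i. Z (NLeaf i)) (Z (rnode mk (p @ [False]) A))" by (rule Tens.IH(1)) (simp add: Tens.prems)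
  moreover have "col B (\<lambda>i. Z (NLeaf i)) (Z (rnode mk (p @ [True]) B))" by (rule Tens.IH(2)) (simp add: Tens.prems)
  moreover have "Z (mk p) = Z (rnode mk (p @ [False]) A)" "Z (mk p) = Z (rnode mk (p @ [True]) B)"
    by (rule Tens.prems; simp)+
  ultimately show ?case by simp
next
  case (Par A B)
  have 1: "col A (\<lambda>i. Z (NLeaf i)) (Z (rnode mk (p @ [False]) A))" by (rule Par.IH(1)) (simp add: Par.prems)
  have 2: "col B (\<lambda>i. Z (NLeaf i)) (Z (rnode mk (p @ [True]) B))" by (rule Par.IH(2)) (simp add: Par.prems)
  show ?case
  proof (cases "s (mk p)")
    case True
    then have "Z (mk p) = Z (rnode mk (p @ [True]) B)" by (intro Par.prems) simp
    then show ?thesis using 1 2 by auto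
  next
    case False
    then have "Z (mk p) = Z (rnode mk (p @ [False]) A)" by (intro Par.prems) simp
    then show ?thesis using 1 2 by auto
  qed
qed simp

text \<open>A transportable witness for \<open>col\<close>: \<open>\<sigma>\<close> gives the
  switches and \<open>\<zeta>\<close> the colours of the inner nodes by path relative to the root,
  and they work wherever the tree is placed.\<close>

definition realises :: "(bool list \<Rightarrow> bool) \<Rightarrow> (bool list \<Rightarrow> bool) \<Rightarrow> (nat \<Rightarrow> bool) \<Rightarrow> tree \<Rightarrow> bool \<Rightarrow> bool" where
  "realises \<sigma> \<zeta> z T c \<longleftrightarrow> (\<forall>mk p s Z. (\<forall>w. s (mk (p @ w)) = \<sigma> w) \<longrightarrow> (\<forall>w. Z (mk (p @ w)) = \<zeta> w) \<longrightarrow>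
     (\<forall>i. Z (NLeaf i) = z i) \<longrightarrow>
     Z (rnode mk p T) = c \<and> (\<forall>a b. (a, b) \<in> swedges s mk p T \<longrightarrow> Z a = Z b))"

lemma realisesD:
  assumes "realises \<sigma> \<zeta> z T c" "\<And>w. s (mk (p @ w)) = \<sigma> w" "\<And>w. Z (mk (p @ w)) = \<zeta> w"
    "\<And>i. Z (NLeaf i) = z i"
  shows "Z (rnode mk p T) = c" "(a, b) \<in> swedges s mk p T \<Longrightarrow> Z a = Z b"
proof -
  have "Z (rnode mk p T) = c \<and> (\<forall>a b. (a, b) \<in> swedges s mk p T \<longrightarrow> Z a = Z b)"
    using assms(2-4) by (intro assms(1)[unfolded realises_def, rule_format]) simp_all
  then show "Z (rnode mk p T) = c" "(a, b) \<in> swedges s mk p T \<Longrightarrow> Z a = Z b" by simp_all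
qed

lemma realises_Tens:
  assumes A: "realises \<sigma>A \<zeta>A z A c" and B: "realises \<sigma>B \<zeta>B z B c"
  shows "realises (glue x \<sigma>A \<sigma>B) (glue c \<zeta>A \<zeta>B) z (Tens A B) c"
  unfolding realises_def
proof (intro allI impI)
  fix mk p s Z
  assume s: "\<forall>w. s (mk (p @ w)) = glue x \<sigma>A \<sigma>B w" and Z: "\<forall>w. Z (mk (p @ w)) = glue c \<zeta>A \<zeta>B w"
    and l: "\<forall>i. Z (NLeaf i) = z i"
  have r: "Z (mk p) = c" using spec[OF Z, of "[]"] by simp
  have wA: "s (mk ((p @ [False]) @ w)) = \<sigma>A w" "Z (mk ((p @ [False]) @ w)) = \<zeta>A w"
    and wB: "s (mk ((p @ [True]) @ w)) = \<sigma>B w" "Z (mk ((p @ [True]) @ w)) = \<zeta>B w"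
    for w using s Z by simp_all
  note a = realisesD[OF A, of s mk "p @ [False]" Z, OF wA spec[OF l]]
    and b = realisesD[OF B, of s mk "p @ [True]" Z, OF wB spec[OF l]]
  show "Z (rnode mk p (Tens A B)) = c \<and> (\<forall>a b. (a, b) \<in> swedges s mk p (Tens A B) \<longrightarrow> Z a = Z b)"
    using a b r by auto
qed

lemma realises_Par:
  assumes A: "realises \<sigma>A \<zeta>A z A cA" and B: "realises \<sigma>B \<zeta>B z B cB" and c: "c = (if x then cB else cA)"
  shows "realises (glue x \<sigma>A \<sigma>B) (glue c \<zeta>A \<zeta>B) z (Par A B) c"
  unfolding realises_def
proof (intro allI impI)
  fix mk p s Z
  assume s: "\<forall>w. s (mk (p @ w)) = glue x \<sigma>A \<sigma>B w" and Z: "\<forall>w. Z (mk (p @ w)) = glue c \<zeta>A \<zeta>B w"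
    and l: "\<forall>i. Z (NLeaf i) = z i"
  have r: "Z (mk p) = c" "s (mk p) = x" using spec[OF Z, of "[]"] spec[OF s, of "[]"] by simp_all
  have wA: "s (mk ((p @ [False]) @ w)) = \<sigma>A w" "Z (mk ((p @ [False]) @ w)) = \<zeta>A w"
    and wB: "s (mk ((p @ [True]) @ w)) = \<sigma>B w" "Z (mk ((p @ [True]) @ w)) = \<zeta>B w"
    for w using s Z by simp_all
  note a = realisesD[OF A, of s mk "p @ [False]" Z, OF wA spec[OF l]]
    and b = realisesD[OF B, of s mk "p @ [True]" Z, OF wB spec[OF l]]
  show "Z (rnode mk p (Par A B)) = c \<and> (\<forall>a b. (a, b) \<in> swedges s mk p (Par A B) \<longrightarrow> Z a = Z b)"
    using a b r c by (auto split: if_splits)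
qed

lemma col_realises: "col T z c \<Longrightarrow> \<exists>\<sigma> \<zeta>. realises \<sigma> \<zeta> z T c"
proof (induction T arbitrary: c)
  case (Leaf l)
  then show ?case by (auto simp: realises_def)
next
  case (Tens A B)
  then show ?case by (metis realises_Tens col.simps(2))
next
  case (Par A B)
  then consider c' where "col A z c" "col B z c'" | c' where "col B z c" "col A z c'" by auto
  then show ?case
  proof cases
    case 1
    then obtain \<sigma>A \<zeta>A \<sigma>B \<zeta>B where "realises \<sigma>A \<zeta>A z A c" "realises \<sigma>B \<zeta>B z B c'" using Par.IH by meson
    from realises_Par[OF this, of c False] show ?thesis by auto
  next
    case 2
    then obtain \<sigma>A \<zeta>A \<sigma>B \<zeta>B where "realises \<sigma>A \<zeta>A z A c'" "realises \<sigma>B \<zeta>B z B c" using Par.IH by meson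
    from realises_Par[OF this, of c True] show ?thesis by auto
  qed
qed

definition sel_realises :: "(bool list \<Rightarrow> bool) \<Rightarrow> (bool list \<Rightarrow> bool) \<Rightarrow> bool \<Rightarrow> (nat \<Rightarrow> bool) \<Rightarrow> sel \<Rightarrow> bool" where
  "sel_realises \<sigma> \<zeta> c z x \<longleftrightarrow> (\<forall>k s Z. (\<forall>w. s (NG k w) = \<sigma> w) \<longrightarrow> (\<forall>w. Z (NG k w) = \<zeta> w) \<longrightarrow>
     Z (NC k) = c \<longrightarrow> (\<forall>i. Z (NLeaf i) = z i) \<longrightarrow> (\<forall>a b. (a, b) \<in> sel_edges s k x \<longrightarrow> Z a = Z b))"

lemma sel_col_realises:
  assumes "sel_col x z"
  shows "\<exists>\<sigma> \<zeta> c. sel_realises \<sigma> \<zeta> c z x"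
proof (cases x)
  case (Form A)
  with assms obtain c where "col A z c" by auto
  then obtain \<sigma> \<zeta> where r: "realises \<sigma> \<zeta> z A c" using col_realises by blast
  have "sel_realises \<sigma> \<zeta> c z x"
    unfolding sel_realises_def
  proof (intro allI impI)
    fix k s Z a b
    assume "\<forall>w. s (NG k w) = \<sigma> w" "\<forall>w. Z (NG k w) = \<zeta> w" "\<forall>i. Z (NLeaf i) = z i"
      "(a, b) \<in> sel_edges s k x"
    then show "Z a = Z b" using realisesD(2)[OF r, of s "NG k" "[]" Z a b] Form by simp
  qed
  then show ?thesis by blast
next
  case (Cut A B)
  with assms obtain c where "col A z c" "col B z c" by auto
  then obtain \<sigma>A \<zeta>A \<sigma>B \<zeta>B where A: "realises \<sigma>A \<zeta>A z A c" and B: "realises \<sigma>B \<zeta>B z B c"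
    using col_realises by meson
  have "sel_realises (glue c \<sigma>A \<sigma>B) (glue c \<zeta>A \<zeta>B) c z x"
    unfolding sel_realises_def
  proof (intro allI impI)
    fix k s Z a b
    assume s: "\<forall>w. s (NG k w) = glue c \<sigma>A \<sigma>B w" and Z: "\<forall>w. Z (NG k w) = glue c \<zeta>A \<zeta>B w"
      and c: "Z (NC k) = c" and l: "\<forall>i. Z (NLeaf i) = z i" and ab: "(a, b) \<in> sel_edges s k x"
    have wA: "s (NG k ([False] @ w)) = \<sigma>A w" "Z (NG k ([False] @ w)) = \<zeta>A w"
      and wB: "s (NG k ([True] @ w)) = \<sigma>B w" "Z (NG k ([True] @ w)) = \<zeta>B w"
      for w using s Z by simp_all
    show "Z a = Z b"
      using realisesD[OF A, of s "NG k" "[False]" Z, OF wA spec[OF l]]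
        realisesD[OF B, of s "NG k" "[True]" Z, OF wB spec[OF l]] Cut c ab by auto
  qed
  then show ?thesis by blast
qed

lemma sequent_colouring:
  assumes "\<forall>x\<in>set \<Gamma>. sel_col x z"
  shows "\<exists>s Z. (\<forall>w. s (NP w) = \<sigma> w) \<and> (\<forall>w. Z (NP w) = \<zeta> w) \<and> (\<forall>i. Z (NLeaf i) = z i) \<and>
    (\<forall>k<length \<Gamma>. \<forall>a b. (a, b) \<in> sel_edges s k (\<Gamma> ! k) \<longrightarrow> Z a = Z b)"
proof -
  have "\<forall>x\<in>set \<Gamma>. \<exists>\<sigma> \<zeta> c. sel_realises \<sigma> \<zeta> c z x" using assms sel_col_realises by blast
  then obtain S C c where SC: "\<forall>x\<in>set \<Gamma>. sel_realises (S x) (C x) (c x) z x" by metis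
  \<comment> \<open>The pieces cannot clash, as each node constructor and each index has its own.
    Leaves and cut nodes have no switch, hence the default \<open>False\<close>.\<close>
  let ?s = "\<lambda>x. case x of NP w \<Rightarrow> \<sigma> w | NG k w \<Rightarrow> S (\<Gamma> ! k) w | _ \<Rightarrow> False"
  let ?Z = "\<lambda>x. case x of NLeaf i \<Rightarrow> z i | NP w \<Rightarrow> \<zeta> w | NG k w \<Rightarrow> C (\<Gamma> ! k) w | NC k \<Rightarrow> c (\<Gamma> ! k)"
  have "?Z a = ?Z b" if "k < length \<Gamma>" "(a, b) \<in> sel_edges ?s k (\<Gamma> ! k)" for k a b
  proof -
    have r: "sel_realises (S (\<Gamma> ! k)) (C (\<Gamma> ! k)) (c (\<Gamma> ! k)) z (\<Gamma> ! k)" using SC that(1) by simp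
    show ?thesis
      by (rule r[unfolded sel_realises_def, rule_format, OF _ _ _ _ that(2)]) simp_all
  qed
  then show ?thesis by (intro exI[of _ ?s] exI[of _ ?Z]) simp
qed

lemma sel_node_conn_leaf:
  assumes "x \<in> sel_nodes k X"
  shows "\<exists>l\<in>set (sel_leaves X). conn (sel_edges s k X) x (NLeaf (fst l))"
proof (cases X)
  case (Form A)
  then show ?thesis using node_conn_leaf[of x "NG k" "[]" A s] assms by simp
next
  case (Cut A B)
  have up: "conn (sel_edges s k X) u v" if "conn (swedges s (NG k) [False] A) u v" for u v
    using that by (rule conn_mono) (auto simp: Cut)
  have up': "conn (sel_edges s k X) u v" if "conn (swedges s (NG k) [True] B) u v" for u v
    using that by (rule conn_mono) (auto simp: Cut)
  from assms Cut consider "x = NC k" | "x \<in> tnodes (NG k) [False] A" | "x \<in> tnodes (NG k) [True] B" by auto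
  then show ?thesis
  proof cases
    case 1
    from node_conn_leaf[OF rnode_in_tnodes, where s = s] obtain l where l: "l \<in> set (leaves A)"
      "conn (swedges s (NG k) [False] A) (rnode (NG k) [False] A) (NLeaf (fst l))" by blast
    have "conn (sel_edges s k X) (NC k) (rnode (NG k) [False] A)" by (rule conn_edge) (simp add: Cut)
    from conn_trans[OF this up[OF l(2)]] show ?thesis using l(1) 1 Cut by auto
  next
    case 2
    from node_conn_leaf[OF this] obtain l where "l \<in> set (leaves A)"
      "conn (swedges s (NG k) [False] A) x (NLeaf (fst l))" by blast
    then show ?thesis using up Cut by auto
  next
    case 3
    from node_conn_leaf[OF this] obtain l where "l \<in> set (leaves B)"
      "conn (swedges s (NG k) [True] B) x (NLeaf (fst l))" by blast
    then show ?thesis using up' Cut by auto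
  qed
qed

lemma sel_col_of_colouring:
  assumes Z: "\<And>a b. (a, b) \<in> sel_edges s k X \<Longrightarrow> Z a = Z b"
  shows "sel_col X (\<lambda>i. Z (NLeaf i))"
proof (cases X)
  case (Form A)
  then show ?thesis using col_of_colouring[of s "NG k" "[]" A Z] Z by auto
next
  case (Cut A B)
  have "col A (\<lambda>i. Z (NLeaf i)) (Z (rnode (NG k) [False] A))"
    "col B (\<lambda>i. Z (NLeaf i)) (Z (rnode (NG k) [True] B))"
    by (rule col_of_colouring[of s], rule Z, simp add: Cut)+
  moreover have "Z (NC k) = Z (rnode (NG k) [False] A)" "Z (NC k) = Z (rnode (NG k) [True] B)"
    by (rule Z, simp add: Cut)+
  ultimately show ?thesis using Cut by auto
qed

lemma graph_node_conn_leaf: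
  assumes "set (leaves P) = set (concat (map sel_leaves \<Gamma>))" and "x \<in> graph_nodes P \<Gamma>"
  shows "\<exists>l\<in>set (leaves P). conn (sw_graph s P \<Gamma>) x (NLeaf (fst l))"
proof -
  from assms(2) consider "x \<in> tnodes NP [] P" | k where "k < length \<Gamma>" "x \<in> sel_nodes k (\<Gamma> ! k)"
    by (auto simp: graph_nodes_def)
  then show ?thesis
  proof cases
    case 1
    from node_conn_leaf[OF this] obtain l where l: "l \<in> set (leaves P)"
      "conn (swedges s NP [] P) x (NLeaf (fst l))" by blast
    have "conn (sw_graph s P \<Gamma>) x (NLeaf (fst l))"
      using l(2) by (rule conn_mono) (auto simp: sw_graph_def)
    with l(1) show ?thesis by blast
  next
    case 2
    from sel_node_conn_leaf[OF 2(2)] obtain l where l: "l \<in> set (sel_leaves (\<Gamma> ! k))"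
      "conn (sel_edges s k (\<Gamma> ! k)) x (NLeaf (fst l))" by blast
    have "l \<in> set (leaves P)" unfolding assms(1) using l(1) 2(1) nth_mem[OF 2(1)] by auto
    moreover have "conn (sw_graph s P \<Gamma>) x (NLeaf (fst l))"
      using l(2) by (rule conn_mono) (use 2(1) in \<open>auto simp: sw_graph_def\<close>)
    ultimately show ?thesis by blast
  qed
qed

text \<open>Left to right, a colouring that is constant along edges is constant on a connected
  graph. Right to left, colour each node by whether it is connected to \<open>u\<close>: constancy
  on leaves gives every leaf the colour of \<open>u\<close>, and every node reaches a leaf.\<close>

lemma connected_iff_colours_constant:
  assumes lv: "set (leaves P) = set (concat (map sel_leaves \<Gamma>))"
  shows "(\<forall>s. connected_on (graph_nodes P \<Gamma>) (sw_graph s P \<Gamma>)) \<longleftrightarrow> colours_constant P \<Gamma>"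
proof
  assume co: "\<forall>s. connected_on (graph_nodes P \<Gamma>) (sw_graph s P \<Gamma>)"
  show "colours_constant P \<Gamma>"
    unfolding colours_constant_def
  proof (intro allI impI ballI)
    fix z l l'
    assume "\<exists>c. col P z c" and g: "\<forall>x\<in>set \<Gamma>. sel_col x z" and l: "l \<in> set (leaves P)" "l' \<in> set (leaves P)"
    then obtain c \<sigma> \<zeta> where r: "realises \<sigma> \<zeta> z P c" using col_realises by blast
    from sequent_colouring[OF g, of \<sigma> \<zeta>] obtain s Z where s: "\<forall>w. s (NP w) = \<sigma> w" "\<forall>w. Z (NP w) = \<zeta> w"
      "\<forall>i. Z (NLeaf i) = z i" "\<forall>k<length \<Gamma>. \<forall>a b. (a, b) \<in> sel_edges s k (\<Gamma> ! k) \<longrightarrow> Z a = Z b" by blast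
    have Z: "Z a = Z b" if "(a, b) \<in> sw_graph s P \<Gamma>" for a b
    proof -
      from that consider "(a, b) \<in> swedges s NP [] P" | k where "k < length \<Gamma>" "(a, b) \<in> sel_edges s k (\<Gamma> ! k)"
        by (auto simp: sw_graph_def)
      then show ?thesis
      proof cases
        case 1
        show ?thesis by (rule realisesD(2)[OF r _ _ _ 1]) (simp_all add: s)
      qed (use s(4) in blast)
    qed
    have "conn (sw_graph s P \<Gamma>) (NLeaf (fst l)) (NLeaf (fst l'))"
      using co l by (simp add: connected_on_def graph_nodes_def leaf_in_tnodes)
    from conn_colour[OF this, of Z] Z have "Z (NLeaf (fst l)) = Z (NLeaf (fst l'))" by simp
    then show "z (fst l) = z (fst l')" using s(3) by simp
  qed
next
  assume cc: "colours_constant P \<Gamma>"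
  show "\<forall>s. connected_on (graph_nodes P \<Gamma>) (sw_graph s P \<Gamma>)"
    unfolding connected_on_def
  proof (intro allI ballI)
    fix s u v assume uv: "u \<in> graph_nodes P \<Gamma>" "v \<in> graph_nodes P \<Gamma>"
    define Z where "Z x = conn (sw_graph s P \<Gamma>) u x" for x
    have Z: "Z a = Z b" if "(a, b) \<in> sw_graph s P \<Gamma>" for a b
      using conn_trans[OF _ conn_edge[OF that], of u] conn_trans[OF _ conn_edge'[OF that], of u]
      unfolding Z_def by blast
    have "col P (\<lambda>i. Z (NLeaf i)) (Z (rnode NP [] P))"
      by (rule col_of_colouring[of s], rule Z) (simp add: sw_graph_def)
    moreover have "sel_col x (\<lambda>i. Z (NLeaf i))" if x: "x \<in> set \<Gamma>" for x
    proof -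
      obtain k where k: "k < length \<Gamma>" "x = \<Gamma> ! k" using x by (auto simp: in_set_conv_nth)
      show ?thesis by (rule sel_col_of_colouring[of s k], rule Z) (use k in \<open>auto simp: sw_graph_def\<close>)
    qed
    ultimately have c: "Z (NLeaf (fst l)) = Z (NLeaf (fst l'))"
      if "l \<in> set (leaves P)" "l' \<in> set (leaves P)" for l l'
      using cc that unfolding colours_constant_def by blast
    from graph_node_conn_leaf[OF lv uv(1)] obtain l where l: "l \<in> set (leaves P)" "Z (NLeaf (fst l))"
      unfolding Z_def by blast
    from graph_node_conn_leaf[OF lv uv(2)] obtain l' where l': "l' \<in> set (leaves P)"
      "conn (sw_graph s P \<Gamma>) v (NLeaf (fst l'))" by blast
    have "Z (NLeaf (fst l'))" using c l l' by blast
    then show "conn (sw_graph s P \<Gamma>) u v" using conn_sym[OF l'(2)] unfolding Z_def by (rule conn_trans)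
  qed
qed

text \<open>The analogue of \<open>realises\<close> for a tree with a hole at \<open>p\<close>.
  Switches and colours are prescribed only on paths that do not run through \<open>p\<close>;
  \<open>d\<close> is the colour at the root of the hole and \<open>c\<close> the colour at the root
  of the whole tree.\<close>

definition realises_ctx :: "(bool list \<Rightarrow> bool) \<Rightarrow> (bool list \<Rightarrow> bool) \<Rightarrow> (nat \<Rightarrow> bool) \<Rightarrow> tree \<Rightarrow> bool list \<Rightarrow>
    tree \<Rightarrow> bool \<Rightarrow> bool \<Rightarrow> bool" where
  "realises_ctx \<sigma> \<zeta> z P p X d c \<longleftrightarrow> (\<forall>mk q s Z.
     (\<forall>w. take (length p) w \<noteq> p \<longrightarrow> s (mk (q @ w)) = \<sigma> w \<and> Z (mk (q @ w)) = \<zeta> w) \<longrightarrow>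
     (\<forall>i. Z (NLeaf i) = z i) \<longrightarrow> Z (rnode mk (q @ p) X) = d \<longrightarrow>
     Z (rnode mk q P) = c \<and>
     (\<forall>a b. (a, b) \<in> swedges s mk q P \<longrightarrow> (\<nexists>w. a = mk (q @ p @ w)) \<longrightarrow> Z a = Z b))"

lemma realises_ctxD:
  assumes "realises_ctx \<sigma> \<zeta> z P p X d c" "\<And>w. take (length p) w \<noteq> p \<Longrightarrow> s (mk (q @ w)) = \<sigma> w"
    "\<And>w. take (length p) w \<noteq> p \<Longrightarrow> Z (mk (q @ w)) = \<zeta> w"
    "\<And>i. Z (NLeaf i) = z i" "Z (rnode mk (q @ p) X) = d"
  shows "Z (rnode mk q P) = c" "(a, b) \<in> swedges s mk q P \<Longrightarrow> \<nexists>w. a = mk (q @ p @ w) \<Longrightarrow> Z a = Z b"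
proof -
  have "Z (rnode mk q P) = c \<and>
      (\<forall>a b. (a, b) \<in> swedges s mk q P \<longrightarrow> (\<nexists>w. a = mk (q @ p @ w)) \<longrightarrow> Z a = Z b)"
    using assms(2-5) by (intro assms(1)[unfolded realises_ctx_def, rule_format]) simp_all
  then show "Z (rnode mk q P) = c" "(a, b) \<in> swedges s mk q P \<Longrightarrow> \<nexists>w. a = mk (q @ p @ w) \<Longrightarrow> Z a = Z b"
    by blast+
qed

lemma realises_ctx_TensL:
  assumes A: "realises_ctx \<sigma>A \<zeta>A z A p X d c" and B: "realises \<sigma>B \<zeta>B z B c"
  shows "realises_ctx (glue x \<sigma>A \<sigma>B) (glue c \<zeta>A \<zeta>B) z (Tens A B) (False # p) X d c"
  unfolding realises_ctx_def
proof (intro allI impI)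
  fix mk q s Z
  assume w: "\<forall>w. take (length (False # p)) w \<noteq> False # p \<longrightarrow>
      s (mk (q @ w)) = glue x \<sigma>A \<sigma>B w \<and> Z (mk (q @ w)) = glue c \<zeta>A \<zeta>B w"
    and l: "\<forall>i. Z (NLeaf i) = z i" and d: "Z (rnode mk (q @ False # p) X) = d"
  have r: "Z (mk q) = c" using spec[OF w, of "[]"] by simp
  have wA: "s (mk ((q @ [False]) @ w)) = \<sigma>A w" "Z (mk ((q @ [False]) @ w)) = \<zeta>A w"
    if "take (length p) w \<noteq> p" for w using spec[OF w, of "False # w"] that by simp_all
  have wB: "s (mk ((q @ [True]) @ w)) = \<sigma>B w" "Z (mk ((q @ [True]) @ w)) = \<zeta>B w"
    for w using spec[OF w, of "True # w"] by simp_all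
  note a = realises_ctxD[OF A, of s mk "q @ [False]" Z, OF wA spec[OF l]]
    and b = realisesD[OF B, of s mk "q @ [True]" Z, OF wB spec[OF l]]
  show "Z (rnode mk q (Tens A B)) = c \<and> (\<forall>a b. (a, b) \<in> swedges s mk q (Tens A B) \<longrightarrow>
      (\<nexists>w. a = mk (q @ (False # p) @ w)) \<longrightarrow> Z a = Z b)"
    using a b r d by auto
qed

lemma realises_ctx_TensR:
  assumes A: "realises \<sigma>A \<zeta>A z A c" and B: "realises_ctx \<sigma>B \<zeta>B z B p X d c"
  shows "realises_ctx (glue x \<sigma>A \<sigma>B) (glue c \<zeta>A \<zeta>B) z (Tens A B) (True # p) X d c"
  unfolding realises_ctx_def
proof (intro allI impI)
  fix mk q s Z
  assume w: "\<forall>w. take (length (True # p)) w \<noteq> True # p \<longrightarrow>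
      s (mk (q @ w)) = glue x \<sigma>A \<sigma>B w \<and> Z (mk (q @ w)) = glue c \<zeta>A \<zeta>B w"
    and l: "\<forall>i. Z (NLeaf i) = z i" and d: "Z (rnode mk (q @ True # p) X) = d"
  have r: "Z (mk q) = c" using spec[OF w, of "[]"] by simp
  have wB: "s (mk ((q @ [True]) @ w)) = \<sigma>B w" "Z (mk ((q @ [True]) @ w)) = \<zeta>B w"
    if "take (length p) w \<noteq> p" for w using spec[OF w, of "True # w"] that by simp_all
  have wA: "s (mk ((q @ [False]) @ w)) = \<sigma>A w" "Z (mk ((q @ [False]) @ w)) = \<zeta>A w"
    for w using spec[OF w, of "False # w"] by simp_all
  note a = realises_ctxD[OF B, of s mk "q @ [True]" Z, OF wB spec[OF l]]
    and b = realisesD[OF A, of s mk "q @ [False]" Z, OF wA spec[OF l]]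
  show "Z (rnode mk q (Tens A B)) = c \<and> (\<forall>a b. (a, b) \<in> swedges s mk q (Tens A B) \<longrightarrow>
      (\<nexists>w. a = mk (q @ (True # p) @ w)) \<longrightarrow> Z a = Z b)"
    using a b r d by auto
qed

lemma realises_ctx_ParL:
  assumes A: "realises_ctx \<sigma>A \<zeta>A z A p X d cA" and B: "realises \<sigma>B \<zeta>B z B cB" and c: "c = (if x then cB else cA)"
  shows "realises_ctx (glue x \<sigma>A \<sigma>B) (glue c \<zeta>A \<zeta>B) z (Par A B) (False # p) X d c"
  unfolding realises_ctx_def
proof (intro allI impI)
  fix mk q s Z
  assume w: "\<forall>w. take (length (False # p)) w \<noteq> False # p \<longrightarrow>
      s (mk (q @ w)) = glue x \<sigma>A \<sigma>B w \<and> Z (mk (q @ w)) = glue c \<zeta>A \<zeta>B w"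
    and l: "\<forall>i. Z (NLeaf i) = z i" and d: "Z (rnode mk (q @ False # p) X) = d"
  have r: "Z (mk q) = c" "s (mk q) = x" using spec[OF w, of "[]"] by simp_all
  have wA: "s (mk ((q @ [False]) @ w)) = \<sigma>A w" "Z (mk ((q @ [False]) @ w)) = \<zeta>A w"
    if "take (length p) w \<noteq> p" for w using spec[OF w, of "False # w"] that by simp_all
  have wB: "s (mk ((q @ [True]) @ w)) = \<sigma>B w" "Z (mk ((q @ [True]) @ w)) = \<zeta>B w"
    for w using spec[OF w, of "True # w"] by simp_all
  note a = realises_ctxD[OF A, of s mk "q @ [False]" Z, OF wA spec[OF l]]
    and b = realisesD[OF B, of s mk "q @ [True]" Z, OF wB spec[OF l]]
  show "Z (rnode mk q (Par A B)) = c \<and> (\<forall>a b. (a, b) \<in> swedges s mk q (Par A B) \<longrightarrow>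
      (\<nexists>w. a = mk (q @ (False # p) @ w)) \<longrightarrow> Z a = Z b)"
    using a b r d c by (auto split: if_splits)
qed

lemma realises_ctx_ParR:
  assumes A: "realises \<sigma>A \<zeta>A z A cA" and B: "realises_ctx \<sigma>B \<zeta>B z B p X d cB" and c: "c = (if x then cB else cA)"
  shows "realises_ctx (glue x \<sigma>A \<sigma>B) (glue c \<zeta>A \<zeta>B) z (Par A B) (True # p) X d c"
  unfolding realises_ctx_def
proof (intro allI impI)
  fix mk q s Z
  assume w: "\<forall>w. take (length (True # p)) w \<noteq> True # p \<longrightarrow>
      s (mk (q @ w)) = glue x \<sigma>A \<sigma>B w \<and> Z (mk (q @ w)) = glue c \<zeta>A \<zeta>B w"
    and l: "\<forall>i. Z (NLeaf i) = z i" and d: "Z (rnode mk (q @ True # p) X) = d"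
  have r: "Z (mk q) = c" "s (mk q) = x" using spec[OF w, of "[]"] by simp_all
  have wB: "s (mk ((q @ [True]) @ w)) = \<sigma>B w" "Z (mk ((q @ [True]) @ w)) = \<zeta>B w"
    if "take (length p) w \<noteq> p" for w using spec[OF w, of "True # w"] that by simp_all
  have wA: "s (mk ((q @ [False]) @ w)) = \<sigma>A w" "Z (mk ((q @ [False]) @ w)) = \<zeta>A w"
    for w using spec[OF w, of "False # w"] by simp_all
  note a = realises_ctxD[OF B, of s mk "q @ [True]" Z, OF wB spec[OF l]]
    and b = realisesD[OF A, of s mk "q @ [False]" Z, OF wA spec[OF l]]
  show "Z (rnode mk q (Par A B)) = c \<and> (\<forall>a b. (a, b) \<in> swedges s mk q (Par A B) \<longrightarrow>
      (\<nexists>w. a = mk (q @ (True # p) @ w)) \<longrightarrow> Z a = Z b)"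
    using a b r d c by (auto split: if_splits)
qed

text \<open>The context sees the tree in the hole only through its root colour \<open>d\<close>. So
  another tree with the same root colour fits, and the surroundings can be realised as nodes of the
  original \<open>P\<close>, around its subtree \<open>X\<close>.\<close>

lemma col_ctx:
  "subtree_at P p = Some X \<Longrightarrow> col (replace_at P p Y) z c \<Longrightarrow>
    \<exists>d. col Y z d \<and> (\<forall>Y'. col Y' z d \<longrightarrow> col (replace_at P p Y') z c) \<and>
      (\<exists>\<sigma> \<zeta>. realises_ctx \<sigma> \<zeta> z P p X d c)"
proof (induction P p arbitrary: c rule: subtree_at.induct)
  case (1 T)
  \<comment> \<open>With the hole at the root every path runs through it, so both functions are
    arbitrary.\<close>
  have "realises_ctx (\<lambda>_. False) (\<lambda>_. False) z X [] X c c"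
    unfolding realises_ctx_def by (auto dest: swedges_source)
  then show ?case using 1 by auto
next
  case (3 A B p)
  from 3(3) have B: "col B z c" and A: "col (replace_at A p Y) z c" by simp_all
  from 3(1)[OF _ A] 3(2) obtain d \<sigma> \<zeta> where d: "col Y z d"
    "\<forall>Y'. col Y' z d \<longrightarrow> col (replace_at A p Y') z c" "realises_ctx \<sigma> \<zeta> z A p X d c" by auto
  from col_realises[OF B] obtain \<sigma>' \<zeta>' where "realises \<sigma>' \<zeta>' z B c" by blast
  from realises_ctx_TensL[OF d(3) this] d B show ?case by auto
next
  case (4 A B p)
  from 4(3) have A: "col A z c" and B: "col (replace_at B p Y) z c" by simp_all
  from 4(1)[OF _ B] 4(2) obtain d \<sigma> \<zeta> where d: "col Y z d"
    "\<forall>Y'. col Y' z d \<longrightarrow> col (replace_at B p Y') z c" "realises_ctx \<sigma> \<zeta> z B p X d c" by auto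
  from col_realises[OF A] obtain \<sigma>' \<zeta>' where "realises \<sigma>' \<zeta>' z A c" by blast
  from realises_ctx_TensR[OF this d(3)] d A show ?case by auto
next
  case (5 A B p)
  \<comment> \<open>\<open>x\<close> plays the switch of the par: it tells which child passes its
    colour on.\<close>
  from 5(3) obtain cA cB x where cs: "col (replace_at A p Y) z cA" "col B z cB" "c = (if x then cB else cA)"
    by simp (metis (full_types))
  from 5(1)[OF _ cs(1)] 5(2) obtain d \<sigma> \<zeta> where d: "col Y z d"
    "\<forall>Y'. col Y' z d \<longrightarrow> col (replace_at A p Y') z cA" "realises_ctx \<sigma> \<zeta> z A p X d cA" by auto
  from col_realises[OF cs(2)] obtain \<sigma>' \<zeta>' where "realises \<sigma>' \<zeta>' z B cB" by blast
  from realises_ctx_ParL[OF d(3) this cs(3)] have "\<exists>\<sigma> \<zeta>. realises_ctx \<sigma> \<zeta> z (Par A B) (False # p) X d c" by blast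
  moreover have "\<forall>Y'. col Y' z d \<longrightarrow> col (replace_at (Par A B) (False # p) Y') z c"
    using d(2) cs by (auto split: if_splits)
  ultimately show ?case using d(1) by blast
next
  case (6 A B p)
  from 6(3) obtain cA cB x where cs: "col A z cA" "col (replace_at B p Y) z cB" "c = (if x then cB else cA)"
    by simp (metis (full_types))
  from 6(1)[OF _ cs(2)] 6(2) obtain d \<sigma> \<zeta> where d: "col Y z d"
    "\<forall>Y'. col Y' z d \<longrightarrow> col (replace_at B p Y') z cB" "realises_ctx \<sigma> \<zeta> z B p X d cB" by auto
  from col_realises[OF cs(1)] obtain \<sigma>' \<zeta>' where "realises \<sigma>' \<zeta>' z A cA" by blast
  from realises_ctx_ParR[OF this d(3) cs(3)] have "\<exists>\<sigma> \<zeta>. realises_ctx \<sigma> \<zeta> z (Par A B) (True # p) X d c" by blast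
  moreover have "\<forall>Y'. col Y' z d \<longrightarrow> col (replace_at (Par A B) (True # p) Y') z c"
    using d(2) cs by (auto split: if_splits)
  ultimately show ?case using d(1) by blast
qed simp

section \<open>Equivalence steps preserve proof graphs\<close>

fun inner_count :: "tree \<Rightarrow> nat" where
  "inner_count (Leaf l) = 0"
| "inner_count (Tens A B) = Suc (inner_count A + inner_count B)"
| "inner_count (Par A B) = Suc (inner_count A + inner_count B)"

text \<open>No switching occurs here: a par keeps one of its two edges whichever way it is
  switched.\<close>

fun edge_count :: "tree \<Rightarrow> nat" where
  "edge_count (Leaf l) = 0"
| "edge_count (Tens A B) = 2 + edge_count A + edge_count B"
| "edge_count (Par A B) = 1 + edge_count A + edge_count B"

fun inner_paths :: "bool list \<Rightarrow> tree \<Rightarrow> bool list set" where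
  "inner_paths p (Leaf l) = {}"
| "inner_paths p (Tens A B) = insert p (inner_paths (p @ [False]) A \<union> inner_paths (p @ [True]) B)"
| "inner_paths p (Par A B) = insert p (inner_paths (p @ [False]) A \<union> inner_paths (p @ [True]) B)"

lemma inner_paths_prefix: "w \<in> inner_paths p T \<Longrightarrow> \<exists>v. w = p @ v"
  by (induction T arbitrary: p) fastforce+

lemma inner_paths_disjoint:
  "inner_paths (p @ [False]) A \<inter> inner_paths (p @ [True]) B = {}"
  "p \<notin> inner_paths (p @ [x]) A"
  by (auto dest!: inner_paths_prefix)

lemma card_inner_paths: "finite (inner_paths p T) \<and> card (inner_paths p T) = inner_count T"
  by (induction T arbitrary: p) (auto simp: card_Un_disjoint inner_paths_disjoint)

lemma tnodes_inner_paths: "tnodes NP p T = NP ` inner_paths p T \<union> (NLeaf \<circ> fst) ` set (leaves T)"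
  by (induction T arbitrary: p) auto

text \<open>Two sibling roots could coincide only as leaves with the same identifier. Without this,
  the two edges of a tensor might be one.\<close>

lemma rnode_distinct:
  "distinct (map fst (leaves A @ leaves B)) \<Longrightarrow> rnode NP (p @ [False]) A \<noteq> rnode NP (p @ [True]) B"
  by (cases A; cases B) auto

lemma card_swedges:
  "distinct (map fst (leaves T)) \<Longrightarrow> card (swedges s NP p T) = edge_count T"
proof (induction T arbitrary: p)
  case (Tens A B)
  let ?A = "swedges s NP (p @ [False]) A" and ?B = "swedges s NP (p @ [True]) B"
  have "?A \<inter> ?B = {}" by (auto dest!: swedges_source)
  then have "card (?A \<union> ?B) = edge_count A + edge_count B"
    using Tens by (simp add: card_Un_disjoint finite_swedges)
  moreover have "(NP p, x) \<notin> ?A \<union> ?B" for x by (auto dest!: swedges_source)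
  ultimately show ?case using rnode_distinct[of A B p] Tens.prems
    by (simp add: finite_swedges)
next
  case (Par A B)
  let ?A = "swedges s NP (p @ [False]) A" and ?B = "swedges s NP (p @ [True]) B"
  have "?A \<inter> ?B = {}" by (auto dest!: swedges_source)
  then have "card (?A \<union> ?B) = edge_count A + edge_count B"
    using Par by (simp add: card_Un_disjoint finite_swedges)
  moreover have "(NP p, x) \<notin> ?A \<union> ?B" for x by (auto dest!: swedges_source)
  ultimately show ?case by (simp add: finite_swedges)
qed simp

lemma sel_edges_shape:
  assumes "(a, b) \<in> sel_edges s k x"
  shows "(a = NC k \<and> ((\<exists>w. b = NG k w) \<or> (\<exists>i. b = NLeaf i))) \<or>
    (\<exists>w. a = NG k w \<and> ((\<exists>y. b = NG k (w @ [y])) \<or> (\<exists>i. b = NLeaf i)))"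
proof -
  have r: "(\<exists>w. rnode (NG k) p A = NG k w) \<or> (\<exists>i. rnode (NG k) p A = NLeaf i)" for p A
    by (cases A) auto
  have "\<exists>w. a = NG k w \<and> ((\<exists>y. b = NG k (w @ [y])) \<or> (\<exists>i. b = NLeaf i))"
    if "(a, b) \<in> swedges s (NG k) p A" for p A
    using swedges_shape[OF that] by auto
  note sw = this
  show ?thesis
  proof (cases x)
    case (Form A)
    then show ?thesis using assms sw by simp
  next
    case (Cut A B)
    then show ?thesis using assms sw[of "[False]" A] sw[of "[True]" B] r[of "[False]" A] r[of "[True]" B] by auto
  qed
qed

lemma sel_edges_nodes: "sel_edges s k x \<subseteq> sel_nodes k x \<times> sel_nodes k x"
proof (cases x)
  case (Form A)
  then show ?thesis using swedges_tnodes by simp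
next
  case (Cut A B)
  then show ?thesis
    using swedges_tnodes[of s "NG k" "[False]" A] swedges_tnodes[of s "NG k" "[True]" B]
    by (auto simp: rnode_in_tnodes)
qed

lemma sw_graph_nodes: "sw_graph s P \<Gamma> \<subseteq> graph_nodes P \<Gamma> \<times> graph_nodes P \<Gamma>"
  using swedges_tnodes[of s NP "[]" P] sel_edges_nodes
  unfolding sw_graph_def graph_nodes_def by fast

lemma finite_sel_nodes: "finite (sel_nodes k x)"
  by (cases x) (auto simp: finite_tnodes)

lemma finite_sel_edges: "finite (sel_edges s k x)"
  by (cases x) (auto simp: finite_swedges)

lemma finite_graph: "finite (graph_nodes P \<Gamma>)" "finite (sw_graph s P \<Gamma>)"
  by (simp_all add: graph_nodes_def sw_graph_def finite_tnodes finite_swedges finite_sel_nodes finite_sel_edges)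

text \<open>Edges lead from a parent to a deeper node or to a leaf, and leaves have no outgoing
  edges. This provides the premises of \<open>acyclic_bridge\<close>.\<close>

lemma sw_graph_antisym:
  assumes "(a, b) \<in> sw_graph s P \<Gamma>"
  shows "a \<noteq> b" "(b, a) \<notin> sw_graph s P \<Gamma>"
proof -
  have sh: "(\<exists>w. u = NP w \<and> ((\<exists>x. v = NP (w @ [x])) \<or> (\<exists>i. v = NLeaf i))) \<or>
    (\<exists>k. u = NC k \<and> ((\<exists>w. v = NG k w) \<or> (\<exists>i. v = NLeaf i))) \<or>
    (\<exists>k w. u = NG k w \<and> ((\<exists>y. v = NG k (w @ [y])) \<or> (\<exists>i. v = NLeaf i)))"
    if uv: "(u, v) \<in> sw_graph s P \<Gamma>" for u v
  proof -
    from uv consider "(u, v) \<in> swedges s NP [] P" | k where "(u, v) \<in> sel_edges s k (\<Gamma> ! k)"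
      by (auto simp: sw_graph_def)
    then show ?thesis
    proof cases
      case 1
      from swedges_shape[OF this] show ?thesis by auto
    next
      case 2
      from sel_edges_shape[OF this] show ?thesis by blast
    qed
  qed
  show "a \<noteq> b" using sh[OF assms] by auto
  show "(b, a) \<notin> sw_graph s P \<Gamma>"
  proof
    assume "(b, a) \<in> sw_graph s P \<Gamma>"
    from sh[OF this] sh[OF assms] show False by auto
  qed
qed

lemma proof_graph_bridge:
  assumes "proof_graph P \<Gamma>" and "(a, b) \<in> sw_graph s P \<Gamma>"
  shows "\<not> conn (sw_graph s P \<Gamma> - {(a, b)}) a b"
  using assms sw_graph_antisym[OF assms(2)] by (intro acyclic_bridge) (auto simp: proof_graph_def)

lemma card_sw_graph:
  assumes "distinct (map fst (leaves P))"
  shows "card (sw_graph s P \<Gamma>) = edge_count P + card (\<Union>k<length \<Gamma>. sel_edges s k (\<Gamma> ! k))"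
proof -
  have "swedges s NP [] P \<inter> (\<Union>k<length \<Gamma>. sel_edges s k (\<Gamma> ! k)) = {}"
  proof -
    have "(a, b) \<notin> sel_edges s k (\<Gamma> ! k)" if "(a, b) \<in> swedges s NP [] P" for a b k
      using swedges_source[OF that] sel_edges_shape[of a b s k "\<Gamma> ! k"] by auto
    then show ?thesis by auto
  qed
  then show ?thesis
    by (simp add: sw_graph_def card_Un_disjoint finite_swedges finite_sel_edges card_swedges[OF assms])
qed

lemma card_graph_nodes:
  "card (graph_nodes P \<Gamma>) =
    inner_count P + card ((NLeaf \<circ> fst) ` set (leaves P) \<union> (\<Union>k<length \<Gamma>. sel_nodes k (\<Gamma> ! k)))"
proof -
  let ?R = "(NLeaf \<circ> fst) ` set (leaves P) \<union> (\<Union>k<length \<Gamma>. sel_nodes k (\<Gamma> ! k))"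
  have "NP w \<notin> sel_nodes k x" for w k x
    by (cases x) (auto dest: tnodes_shape)
  then have "NP ` inner_paths [] P \<inter> ?R = {}" by auto
  moreover have "graph_nodes P \<Gamma> = NP ` inner_paths [] P \<union> ?R"
    by (auto simp: graph_nodes_def tnodes_inner_paths)
  ultimately show ?thesis
    using card_inner_paths[of "[]" P] by (simp add: card_Un_disjoint finite_sel_nodes card_image inj_on_def)
qed

text \<open>All switchings have the same number of edges, so acyclicity of the new graph follows from
  its connectedness.\<close>

lemma proof_graph_transfer:
  assumes pg: "proof_graph P \<Gamma>" and lk: "is_linking P'" and ms: "mset (leaves P') = mset (leaves P)"
    and ic: "inner_count P' = inner_count P" and ec: "edge_count P' = edge_count P"
    and cc: "colours_constant P' \<Gamma>"
  shows "proof_graph P' \<Gamma>"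
proof -
  have st: "set (leaves P') = set (leaves P)" using ms by (rule mset_eq_setD)
  have di: "distinct (map fst (leaves P))" using pg by (simp add: proof_graph_def)
  have "mset (map fst (leaves P')) = mset (map fst (leaves P))" using ms by simp
  then have di': "distinct (map fst (leaves P'))" using di by (rule mset_eq_imp_distinct_iff[THEN iffD2])
  have lv: "set (leaves P') = set (concat (map sel_leaves \<Gamma>))" using pg st by (simp add: proof_graph_def)
  have co: "connected_on (graph_nodes P' \<Gamma>) (sw_graph s P' \<Gamma>)" for s
    using cc connected_iff_colours_constant[OF lv] by blast
  have "acyclic_on (sw_graph s P' \<Gamma>)" for s
  proof -
    have "\<exists>l. l \<in> set (leaves T)" for T by (induction T) auto
    then obtain l where l: "l \<in> set (leaves P)" by blast
    \<comment> \<open>A leaf is taken as root because its name is the same in both graphs.\<close>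
    let ?r = "NLeaf (fst l)"
    have r: "?r \<in> graph_nodes P \<Gamma>" "?r \<in> graph_nodes P' \<Gamma>"
      using l st by (auto simp: graph_nodes_def leaf_in_tnodes)
    \<comment> \<open>In the old graph every edge is a bridge, which bounds its edges by its nodes
      minus one. Equal counts carry the bound over to the connected new graph.\<close>
    have "card (sw_graph s P \<Gamma>) \<le> card (graph_nodes P \<Gamma> - {?r})"
      by (rule card_edges_le[OF finite_graph(1) sw_graph_nodes r(1)])
        (use pg proof_graph_bridge in \<open>auto simp: proof_graph_def\<close>)
    moreover have "card (sw_graph s P' \<Gamma>) = card (sw_graph s P \<Gamma>)"
      by (simp add: card_sw_graph di di' ec)
    moreover have "card (graph_nodes P' \<Gamma>) = card (graph_nodes P \<Gamma>)"
      by (simp add: card_graph_nodes ic st)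
    ultimately have "card (sw_graph s P' \<Gamma>) \<le> card (graph_nodes P' \<Gamma> - {?r})"
      using r by (simp add: finite_graph)
    then show ?thesis using connected_acyclic[OF finite_graph(2) r(2) co] by blast
  qed
  then show ?thesis using pg lk di' lv co by (simp add: proof_graph_def)
qed

section \<open>Counts and the linking grammar under replacement\<close>

lemma mset_leaves_replace:
  "subtree_at T p = Some X \<Longrightarrow> mset (leaves Y) = mset (leaves X) \<Longrightarrow>
    mset (leaves (replace_at T p Y)) = mset (leaves T)"
  by (induction T p rule: subtree_at.induct) auto

lemma inner_count_replace:
  "subtree_at T p = Some X \<Longrightarrow> inner_count Y = inner_count X \<Longrightarrow> inner_count (replace_at T p Y) = inner_count T"
  by (induction T p rule: subtree_at.induct) auto

lemma edge_count_replace: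
  "subtree_at T p = Some X \<Longrightarrow> edge_count Y = edge_count X \<Longrightarrow> edge_count (replace_at T p Y) = edge_count T"
  by (induction T p rule: subtree_at.induct) auto

inductive_cases is_linking_LeafE: "is_linking (Leaf l)"
inductive_cases is_linking_ParE: "is_linking (Par A B)"
inductive_cases is_linking_TensE: "is_linking (Tens A B)"

text \<open>A leaf below a tensor may be an atom or a bottom, which is not a linking by
  itself.\<close>

lemma is_linking_subtree:
  "is_linking T \<Longrightarrow> subtree_at T p = Some X \<Longrightarrow> \<not> is_leaf X \<Longrightarrow> is_linking X"
proof (induction T p rule: subtree_at.induct)
  case (3 A B p)
  then show ?case by (cases p) (auto elim!: is_linking_TensE)
next
  case (4 A B p)
  then show ?case by (cases p) (auto elim!: is_linking_TensE)
qed (auto elim!: is_linking_ParE)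

text \<open>The premise on \<open>X\<close> rules out the atoms and bottoms below a tensor, whose
  replacement would break the grammar.\<close>

lemma is_linking_replace:
  "is_linking T \<Longrightarrow> subtree_at T p = Some X \<Longrightarrow> is_linking X \<Longrightarrow> is_linking Y \<Longrightarrow> is_linking (replace_at T p Y)"
proof (induction T p rule: subtree_at.induct)
  case (3 A B p)
  then show ?case
    by (cases p) (auto elim!: is_linking_TensE is_linking_LeafE intro: is_linking.intros)
next
  case (4 A B p)
  then show ?case
    by (cases p) (auto elim!: is_linking_TensE is_linking_LeafE intro: is_linking.intros)
qed (auto elim!: is_linking_ParE intro: is_linking.intros)

lemma proof_graph_colours_constant:
  assumes "proof_graph P \<Gamma>"
  shows "colours_constant P \<Gamma>"
proof -
  have "set (leaves P) = set (concat (map sel_leaves \<Gamma>))" using assms by (simp add: proof_graph_def)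
  from connected_iff_colours_constant[OF this] show ?thesis using assms by (simp add: proof_graph_def)
qed

lemma eq_step_pg_equiv:
  assumes "proof_graph P \<Gamma>" "proof_graph P' \<Gamma>" "eq_step \<Gamma> P P'"
  shows "pg_equiv \<Gamma> P P'"
  unfolding pg_equiv_def using assms by (intro r_into_rtranclp) simp

lemma pg_equiv_refl: "pg_equiv \<Gamma> P P"
  by (simp add: pg_equiv_def)

lemma pg_equiv_trans: "pg_equiv \<Gamma> P Q \<Longrightarrow> pg_equiv \<Gamma> Q R \<Longrightarrow> pg_equiv \<Gamma> P R"
  unfolding pg_equiv_def by (rule rtranclp_trans)

lemma eq_rule_linking: "eq_rule X Y \<Longrightarrow> is_linking X \<Longrightarrow> is_linking Y"
  by (cases rule: eq_rule.cases)
    (auto elim!: is_linking_ParE is_linking_TensE is_linking_LeafE intro: is_linking.intros)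

text \<open>Under any leaf colouring, each root colour possible for \<open>Y\<close> is possible for
  \<open>X\<close>. By \<open>col_ctx\<close> every colouring of the new graph colours the old one,
  so constancy is inherited.\<close>

lemma eq_rule_step:
  assumes pg: "proof_graph P \<Gamma>" and sub: "subtree_at P p = Some X" and rule: "eq_rule X Y"
  shows "proof_graph (replace_at P p Y) \<Gamma>" "pg_equiv \<Gamma> P (replace_at P p Y)"
proof -
  have "\<not> is_leaf X" using rule by (auto elim: eq_rule.cases)
  with pg sub have lX: "is_linking X" "is_linking P" by (auto simp: proof_graph_def intro: is_linking_subtree)
  have ms: "mset (leaves Y) = mset (leaves X)" and ic: "inner_count Y = inner_count X"
    and ec: "edge_count Y = edge_count X" using rule by (auto elim!: eq_rule.cases)
  have colXY: "col Y z d \<Longrightarrow> col X z d" for z d using rule by (auto elim!: eq_rule.cases; blast)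
  have cP: "col P z c" if c: "col (replace_at P p Y) z c" for z c
    using col_ctx[OF sub c] colXY replace_at_self[OF sub] by metis
  have ms': "mset (leaves (replace_at P p Y)) = mset (leaves P)" using mset_leaves_replace[OF sub ms] .
  have "colours_constant (replace_at P p Y) \<Gamma>"
    using proof_graph_colours_constant[OF pg] cP unfolding colours_constant_def mset_eq_setD[OF ms'] by blast
  then show pg': "proof_graph (replace_at P p Y) \<Gamma>"
    by (rule proof_graph_transfer[OF pg is_linking_replace[OF lX(2) sub lX(1) eq_rule_linking[OF rule lX(1)]] ms'
          inner_count_replace[OF sub ic] edge_count_replace[OF sub ec]])
  show "pg_equiv \<Gamma> P (replace_at P p Y)"
    by (rule eq_step_pg_equiv[OF pg pg']) (use sub rule in \<open>auto simp: eq_step_def\<close>)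
qed

text \<open>A colouring of the new graph that is not one of the old graph colours the old graph without
  the edge of \<open>\<bottom>\<close>, with Q and \<open>\<bottom>\<close> of one colour and the parent of \<open>\<bottom>\<close> of the other.\<close>

lemma bot_colours_constant:
  assumes pg: "proof_graph P \<Gamma>" and sub: "subtree_at P p = Some (Par Q (Tens R (Leaf (i, LBot))))"
    and side: "bot_side_cond P \<Gamma> p Q i"
  shows "colours_constant (replace_at P p (Tens (Par Q R) (Leaf (i, LBot)))) \<Gamma>"
proof -
  let ?X = "Par Q (Tens R (Leaf (i, LBot)))"
  let ?Y = "Tens (Par Q R) (Leaf (i, LBot))"
  have ms: "set (leaves (replace_at P p ?Y)) = set (leaves P)"
    by (rule mset_eq_setD, rule mset_leaves_replace[OF sub]) simp
  have "col P z c" if c: "col (replace_at P p ?Y) z c" and g: "\<forall>x\<in>set \<Gamma>. sel_col x z" for z c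
  proof -
    from col_ctx[OF sub c] obtain d \<sigma> \<zeta> where d: "col ?Y z d"
      "\<forall>Y'. col Y' z d \<longrightarrow> col (replace_at P p Y') z c"
      and ctx: "realises_ctx \<sigma> \<zeta> z P p ?X d c" by blast
    show "col P z c"
    proof (rule ccontr)
      assume "\<not> col P z c"
      then have nX: "\<not> col ?X z d" using d(2) replace_at_self[OF sub] by metis
      \<comment> \<open>If \<open>R\<close> could take the colour \<open>d\<close> of the bottom, so
        could its tensor with the bottom, and \<open>?X\<close> would get the root colour
        \<open>d\<close>. So \<open>Q\<close> has colour \<open>d\<close> and \<open>R\<close> only
        the opposite one.\<close>
      from d(1) nX have zi: "z i = d" and Q: "col Q z d" by auto
      from d(1) obtain c' where R: "col R z c'" by auto
      with zi Q nX have "c' \<noteq> d" by auto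
      with R have R: "col R z (\<not> d)" by (cases c'; cases d) auto
      obtain \<sigma>Q \<zeta>Q where rQ: "realises \<sigma>Q \<zeta>Q z Q d" using col_realises[OF Q] by blast
      obtain \<sigma>R \<zeta>R where rR: "realises \<sigma>R \<zeta>R z R (\<not> d)" using col_realises[OF R] by blast
      \<comment> \<open>The first \<open>False\<close> switches the par to \<open>Q\<close>; the
        second sits at the tensor, where switches have no effect, and the repeated
        \<open>\<sigma>R\<close> fills the place of the bottom leaf. In \<open>\<zeta>'\<close> the
        tensor node gets the colour of \<open>R\<close>, so only the edge to the bottom violates the
        colouring.\<close>
      define \<sigma>' where "\<sigma>' w = (if take (length p) w = p
        then glue False \<sigma>Q (glue False \<sigma>R \<sigma>R) (drop (length p) w) else \<sigma> w)" for w
      define \<zeta>' where "\<zeta>' w = (if take (length p) w = p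
        then glue d \<zeta>Q (glue (\<not> d) \<zeta>R \<zeta>R) (drop (length p) w) else \<zeta> w)" for w
      from sequent_colouring[OF g, of \<sigma>' \<zeta>'] obtain s Z where s: "\<forall>w. s (NP w) = \<sigma>' w"
        and Z: "\<forall>w. Z (NP w) = \<zeta>' w" and l: "\<forall>i. Z (NLeaf i) = z i"
        and gam: "\<forall>k<length \<Gamma>. \<forall>a b. (a, b) \<in> sel_edges s k (\<Gamma> ! k) \<longrightarrow> Z a = Z b" by blast
      let ?G = "sw_graph s P \<Gamma>"
      let ?e = "(NP (p @ [True]), NLeaf i)"
      have root: "s (NP p) = False" "Z (NP p) = d" "Z (NP (p @ [True])) = (\<not> d)"
        using s Z by (simp_all add: \<sigma>'_def \<zeta>'_def)
      have wQ: "s (NP ((p @ [False]) @ w)) = \<sigma>Q w" "Z (NP ((p @ [False]) @ w)) = \<zeta>Q w"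
        and wR: "s (NP ((p @ [True, False]) @ w)) = \<sigma>R w" "Z (NP ((p @ [True, False]) @ w)) = \<zeta>R w"
        for w using s Z by (simp_all add: \<sigma>'_def \<zeta>'_def)
      have wC: "s (NP ([] @ w)) = \<sigma> w" "Z (NP ([] @ w)) = \<zeta> w" if "take (length p) w \<noteq> p" for w
        using s Z that by (simp_all add: \<sigma>'_def \<zeta>'_def)
      note Qd = realisesD[OF rQ, of s NP "p @ [False]" Z, OF wQ spec[OF l]]
      note Rd = realisesD[OF rR, of s NP "p @ [True, False]" Z, OF wR spec[OF l]]
      have Xd: "Z (rnode NP ([] @ p) ?X) = d" using root by simp
      note Cd = realises_ctxD[OF ctx, of s NP "[]" Z, OF wC spec[OF l] Xd]
      have Ze: "Z a = Z b" if ab: "(a, b) \<in> ?G - {?e}" for a b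
      proof -
        from ab consider "(a, b) \<in> swedges s NP [] P" "\<exists>w. a = NP ([] @ p @ w)"
          | "(a, b) \<in> swedges s NP [] P" "\<nexists>w. a = NP ([] @ p @ w)"
          | k where "k < length \<Gamma>" "(a, b) \<in> sel_edges s k (\<Gamma> ! k)"
          by (auto simp: sw_graph_def)
        then show ?thesis
        proof cases
          case 1
          with swedges_subtree[OF sub, of a b s "[]"] have "(a, b) \<in> swedges s NP ([] @ p) ?X" by blast
          then have "(a, b) = (NP p, rnode NP (p @ [False]) Q) \<or> (a, b) \<in> swedges s NP (p @ [False]) Q \<or>
              (a, b) = (NP (p @ [True]), rnode NP (p @ [True, False]) R) \<or>
              (a, b) \<in> swedges s NP (p @ [True, False]) R"
            using ab root by auto
          then show ?thesis using Qd Rd root by auto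
        next
          case 2
          show ?thesis by (rule Cd(2)) (use 2 in auto)
        next
          case 3
          then show ?thesis using gam by blast
        qed
      qed
      have X: "(a, b) \<in> ?G" if "(a, b) \<in> swedges s NP p ?X" for a b
        using swedges_subtree[OF sub, of a b s "[]"] that by (auto simp: sw_graph_def)
      have "?e \<in> ?G" "(NP p, rnode NP (p @ [False]) Q) \<in> ?G" by (rule X, simp add: root)+
      then have "NP (p @ [True]) \<in> graph_nodes P \<Gamma>" "rnode NP (p @ [False]) Q \<in> graph_nodes P \<Gamma>"
        using sw_graph_nodes by blast+
      then have "conn ?G (NP (p @ [True])) (rnode NP (p @ [False]) Q)"
        using pg by (simp add: proof_graph_def connected_on_def)
      \<comment> \<open>Without the edge to the bottom, the root of \<open>Q\<close> is still
        connected to one of its ends: the tensor node contradicts the colours, the bottom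
        contradicts the side condition.\<close>
      from conn_remove_edge[OF this, of "NP (p @ [True])" "NLeaf i"]
      consider "conn (?G - {?e}) (NP (p @ [True])) (rnode NP (p @ [False]) Q)"
        | "conn (?G - {?e}) (NLeaf i) (rnode NP (p @ [False]) Q)" by blast
      then show False
      proof cases
        case 1
        from conn_colour[OF this, of Z] Ze have "Z (NP (p @ [True])) = Z (rnode NP (p @ [False]) Q)" by blast
        then show False using root Qd(1) by simp
      next
        case 2
        from conn_sym[OF this] side show False
          unfolding bot_side_cond_def using rnode_in_tnodes by blast
      qed
    qed
  qed
  then show ?thesis using proof_graph_colours_constant[OF pg] unfolding colours_constant_def ms by blast
qed

lemma bot_step:
  assumes pg: "proof_graph P \<Gamma>" and sub: "subtree_at P p = Some (Par Q (Tens R (Leaf (i, LBot))))"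
    and side: "bot_side_cond P \<Gamma> p Q i"
  shows "proof_graph (replace_at P p (Tens (Par Q R) (Leaf (i, LBot)))) \<Gamma>"
    "pg_equiv \<Gamma> P (replace_at P p (Tens (Par Q R) (Leaf (i, LBot))))"
proof -
  let ?X = "Par Q (Tens R (Leaf (i, LBot)))"
  let ?Y = "Tens (Par Q R) (Leaf (i, LBot))"
  from pg sub have lX: "is_linking ?X" "is_linking P" by (auto simp: proof_graph_def intro: is_linking_subtree)
  then have lY: "is_linking ?Y"
    by (auto elim!: is_linking_ParE is_linking_TensE is_linking_LeafE intro: is_linking.intros)
  show pg': "proof_graph (replace_at P p ?Y) \<Gamma>"
    by (rule proof_graph_transfer[OF pg is_linking_replace[OF lX(2) sub lX(1) lY]
          mset_leaves_replace[OF sub] inner_count_replace[OF sub] edge_count_replace[OF sub]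
          bot_colours_constant[OF assms]]) simp_all
  show "pg_equiv \<Gamma> P (replace_at P p ?Y)"
  proof (rule eq_step_pg_equiv[OF pg pg'])
    show "eq_step \<Gamma> P (replace_at P p ?Y)"
      unfolding eq_step_def using sub side by (intro exI[of _ p] exI[of _ ?X] exI[of _ ?Y]) blast
  qed
qed

section \<open>Moving \<open>\<bottom>\<close> out of a par\<close>

text \<open>The edges not starting at or below \<open>p\<close>. They depend only on switches
  elsewhere, and they survive any exchange of the inner tree at \<open>p\<close> for another inner
  tree.\<close>

definition outer_graph :: "(node \<Rightarrow> bool) \<Rightarrow> tree \<Rightarrow> sel list \<Rightarrow> bool list \<Rightarrow> (node \<times> node) set" where
  "outer_graph s P \<Gamma> p = {(a, b) \<in> sw_graph s P \<Gamma>. \<nexists>w. a = NP (p @ w)}"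

lemma sel_edges_local: "(a, b) \<in> sel_edges s k x \<Longrightarrow> s a = s' a \<Longrightarrow> (a, b) \<in> sel_edges s' k x"
  by (cases x) (auto dest: swedges_local)

lemma sw_graph_local: "(a, b) \<in> sw_graph s P \<Gamma> \<Longrightarrow> s a = s' a \<Longrightarrow> (a, b) \<in> sw_graph s' P \<Gamma>"
  by (auto simp: sw_graph_def intro: swedges_local sel_edges_local)

lemma outer_graph_local: "(a, b) \<in> outer_graph s P \<Gamma> p \<Longrightarrow> s a = s' a \<Longrightarrow> (a, b) \<in> outer_graph s' P \<Gamma> p"
  by (auto simp: outer_graph_def intro: sw_graph_local)

lemma sel_edges_uniq:
  assumes "(a, b) \<in> sel_edges s k x" "(a, b) \<notin> sel_edges s' k x" "(a, b') \<in> sel_edges s k x"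
  shows "b' = b"
proof -
  have inj: "inj (NG k)" by (simp add: inj_def)
  show ?thesis
  proof (cases x)
    case (Form A)
    then show ?thesis using assms swedges_uniq[OF inj] by simp
  next
    case (Cut A B)
    have "a \<noteq> NC k" using assms(1,2) Cut by (auto dest!: swedges_source)
    moreover have "\<not> ((a, u) \<in> swedges s (NG k) [False] A \<and> (a, v) \<in> swedges s (NG k) [True] B)" for u v
      by (auto dest!: swedges_source)
    ultimately show ?thesis using assms Cut swedges_uniq[OF inj, of a b s _ _ s' b'] by auto
  qed
qed

lemma sw_graph_uniq:
  assumes "(a, b) \<in> sw_graph s P \<Gamma>" "(a, b) \<notin> sw_graph s' P \<Gamma>" "(a, b') \<in> sw_graph s P \<Gamma>"
  shows "b' = b"
proof -
  have inj: "inj NP" by (simp add: inj_def)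
  have sel: "\<exists>w. a = NC k \<or> a = NG k w" if "(a, u) \<in> sel_edges s k (\<Gamma> ! k)" for u k
    using sel_edges_shape[OF that] by blast
  have sw: "\<exists>w. a = NP w" if "(a, u) \<in> swedges s NP [] P" for u
    using swedges_source[OF that] by auto
  from assms(1) consider "(a, b) \<in> swedges s NP [] P"
    | k where "k < length \<Gamma>" "(a, b) \<in> sel_edges s k (\<Gamma> ! k)" by (auto simp: sw_graph_def)
  then show ?thesis
  proof cases
    case 1
    then have "(a, b') \<in> swedges s NP [] P" using assms(3) sel sw[OF 1] by (fastforce simp: sw_graph_def)
    then show ?thesis using swedges_uniq[OF inj 1, of s' b'] assms(2) by (simp add: sw_graph_def)
  next
    case 2
    from assms(3) consider "(a, b') \<in> swedges s NP [] P"
      | j where "j < length \<Gamma>" "(a, b') \<in> sel_edges s j (\<Gamma> ! j)" by (auto simp: sw_graph_def)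
    then show ?thesis
    proof cases
      case 1
      from sw[OF 1] sel[OF 2(2)] show ?thesis by auto
    next
      case (2 j)
      from sel[OF this(2)] sel[OF \<open>(a, b) \<in> sel_edges s k (\<Gamma> ! k)\<close>] have "j = k" by auto
      with 2 \<open>(a, b) \<in> sel_edges s k (\<Gamma> ! k)\<close> assms(2) show ?thesis
        by (intro sel_edges_uniq[of a b s k "\<Gamma> ! k" s' b']) (auto simp: sw_graph_def)
    qed
  qed
qed

lemma outer_graph_uniq:
  "(a, b) \<in> outer_graph s P \<Gamma> p \<Longrightarrow> (a, b) \<notin> outer_graph s' P \<Gamma> p \<Longrightarrow> (a, b') \<in> outer_graph s P \<Gamma> p \<Longrightarrow> b' = b"
  using sw_graph_uniq by (auto simp: outer_graph_def)

lemma outer_graph_replace: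
  assumes "subtree_at P p = Some X" "\<not> is_leaf X" "\<not> is_leaf Y"
  shows "outer_graph s (replace_at P p Y) \<Gamma> p = outer_graph s P \<Gamma> p"
  using swedges_replace[OF assms, of _ "[]" _ s] by (auto simp: outer_graph_def sw_graph_def)

lemma subtree_in_graph:
  assumes "subtree_at P p = Some X"
  shows "swedges s NP p X \<subseteq> sw_graph s P \<Gamma>"
  using swedges_subtree[OF assms, of _ _ s "[]"] by (auto simp: sw_graph_def)

lemma sw_graph_split:
  assumes "subtree_at P p = Some X"
  shows "sw_graph s P \<Gamma> = outer_graph s P \<Gamma> p \<union> swedges s NP p X"
  using swedges_subtree[OF assms, of _ _ s "[]"] subtree_in_graph[OF assms, of s \<Gamma>] sel_edges_shape
  by (fastforce simp: sw_graph_def outer_graph_def)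

text \<open>The only edge into an inner node strictly below \<open>p\<close> comes from its parent,
  which is itself at or below \<open>p\<close>.\<close>

lemma outer_graph_isolated:
  assumes "w \<noteq> []"
  shows "\<not> adj (outer_graph s P \<Gamma> p) (NP (p @ w)) v"
proof
  assume "adj (outer_graph s P \<Gamma> p) (NP (p @ w)) v"
  then have "(v, NP (p @ w)) \<in> sw_graph s P \<Gamma>" and v: "\<nexists>w. v = NP (p @ w)"
    by (auto simp: adj_def outer_graph_def)
  then consider "(v, NP (p @ w)) \<in> swedges s NP [] P" | k where "(v, NP (p @ w)) \<in> sel_edges s k (\<Gamma> ! k)"
    by (auto simp: sw_graph_def)
  then show False
  proof cases
    case 1
    from swedges_shape[OF this] obtain u x where "v = NP u" "p @ w = u @ [x]" by auto
    then have "u = p @ butlast w" using assms by (metis butlast_append butlast_snoc)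
    then show False using v \<open>v = NP u\<close> by auto
  next
    case 2
    from sel_edges_shape[OF this] show False by auto
  qed
qed

text \<open>Sets all switches at and below \<open>p\<close> anew, by relative path. Connections in
  the outer graph persist.\<close>

definition override :: "(node \<Rightarrow> bool) \<Rightarrow> bool list \<Rightarrow> (bool list \<Rightarrow> bool) \<Rightarrow> node \<Rightarrow> bool" where
  "override s p \<sigma> x = (case x of NP v \<Rightarrow> if take (length p) v = p then \<sigma> (drop (length p) v) else s x | _ \<Rightarrow> s x)"

lemma override_in [simp]: "override s p \<sigma> (NP (p @ w)) = \<sigma> w"
  by (simp add: override_def)

lemma override_out:
  assumes "\<nexists>w. x = NP (p @ w)"
  shows "override s p \<sigma> x = s x"
proof (cases x)
  case (NP v)
  have "take (length p) v \<noteq> p"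
  proof
    assume "take (length p) v = p"
    then have "v = p @ drop (length p) v" by (metis append_take_drop_id)
    then show False using assms NP by blast
  qed
  then show ?thesis using NP by (simp add: override_def)
qed (simp_all add: override_def)

lemma outer_graph_override: "outer_graph s P \<Gamma> p \<subseteq> outer_graph (override s p \<sigma>) P \<Gamma> p"
proof clarify
  fix a b assume ab: "(a, b) \<in> outer_graph s P \<Gamma> p"
  then have "\<nexists>w. a = NP (p @ w)" by (simp add: outer_graph_def)
  from override_out[OF this, of s \<sigma>] show "(a, b) \<in> outer_graph (override s p \<sigma>) P \<Gamma> p"
    using outer_graph_local[OF ab, of "override s p \<sigma>"] by simp
qed

text \<open>A tensor keeps both edges in every switching, so connecting its children without these
  edges closes a cycle. The later contradictions all consist in exhibiting a suitable
  \<open>H\<close>, which may still contain the edge from above into the tensor.\<close>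

lemma tens_separates:
  assumes pg: "proof_graph P \<Gamma>" and sub: "subtree_at P w = Some (Tens A B)"
    and H: "H \<subseteq> sw_graph s P \<Gamma>" "\<And>b. (NP w, b) \<notin> H"
  shows "\<not> conn H (rnode NP (w @ [False]) A) (rnode NP (w @ [True]) B)"
    "\<not> conn H (NP w) (rnode NP (w @ [True]) B)"
proof -
  let ?G = "sw_graph s P \<Gamma>"
  let ?a = "rnode NP (w @ [False]) A" and ?b = "rnode NP (w @ [True]) B"
  have "distinct (map fst (leaves A @ leaves B))"
    using subtree_distinct[OF sub] pg by (simp add: proof_graph_def)
  then have ne: "?a \<noteq> ?b" by (rule rnode_distinct)
  have in_G: "(NP w, ?a) \<in> ?G" "(NP w, ?b) \<in> ?G" using subtree_in_graph[OF sub, of s \<Gamma>] by auto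
  have HG: "H \<subseteq> ?G - {(NP w, ?b)}" using H by auto
  have br: "\<not> conn (?G - {(NP w, ?b)}) (NP w) ?b" by (rule proof_graph_bridge[OF pg in_G(2)])
  then show "\<not> conn H (NP w) ?b" using conn_mono[OF _ HG] by blast
  have "conn (?G - {(NP w, ?b)}) (NP w) ?a" using in_G ne by (intro conn_edge) simp
  from conn_trans[OF this, of ?b] br show "\<not> conn H ?a ?b" using conn_mono[OF _ HG] by blast
qed

text \<open>A connection within \<open>T\<close> alone. The switches are relative to the root, so
  they can be combined with choices for other subtrees and with any outer graph.\<close>

definition joinable :: "tree \<Rightarrow> leaf \<Rightarrow> leaf \<Rightarrow> bool" where
  "joinable T l l' \<longleftrightarrow> (\<exists>\<sigma>. \<forall>s p. (\<forall>w. s (NP (p @ w)) = \<sigma> w) \<longrightarrow>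
     conn (swedges s NP p T) (NLeaf (fst l)) (NLeaf (fst l')))"

lemma joinable_refl: "joinable T l l"
  by (simp add: joinable_def)

lemma joinable_sym:
  assumes "joinable T l l'"
  shows "joinable T l' l"
proof -
  from assms obtain \<sigma> where "\<And>s p. (\<forall>w. s (NP (p @ w)) = \<sigma> w) \<Longrightarrow>
    conn (swedges s NP p T) (NLeaf (fst l)) (NLeaf (fst l'))" unfolding joinable_def by blast
  from conn_sym[OF this] show ?thesis unfolding joinable_def by blast
qed

lemma joinable_Tens:
  assumes "l \<in> set (leaves A)" "l' \<in> set (leaves B)"
  shows "joinable (Tens A B) l l'"
proof -
  from switch_to_leaf[OF assms(1), of NP] obtain \<sigma>A where
    A: "\<And>s p. (\<forall>w. s (NP (p @ w)) = \<sigma>A w) \<Longrightarrow> conn (swedges s NP p A) (rnode NP p A) (NLeaf (fst l))" by blast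
  from switch_to_leaf[OF assms(2), of NP] obtain \<sigma>B where
    B: "\<And>s p. (\<forall>w. s (NP (p @ w)) = \<sigma>B w) \<Longrightarrow> conn (swedges s NP p B) (rnode NP p B) (NLeaf (fst l'))" by blast
  have "conn (swedges s NP p (Tens A B)) (NLeaf (fst l)) (NLeaf (fst l'))"
    if s: "\<forall>w. s (NP (p @ w)) = glue False \<sigma>A \<sigma>B w" for s p
  proof -
    let ?E = "swedges s NP p (Tens A B)"
    have "conn (swedges s NP (p @ [False]) A) (rnode NP (p @ [False]) A) (NLeaf (fst l))" by (rule A) (simp add: s)
    then have 1: "conn ?E (rnode NP (p @ [False]) A) (NLeaf (fst l))" by (rule conn_mono) auto
    have "conn (swedges s NP (p @ [True]) B) (rnode NP (p @ [True]) B) (NLeaf (fst l'))" by (rule B) (simp add: s)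
    then have 2: "conn ?E (rnode NP (p @ [True]) B) (NLeaf (fst l'))" by (rule conn_mono) auto
    have 3: "conn ?E (rnode NP (p @ [False]) A) (NP p)" by (rule conn_edge') simp
    have 4: "conn ?E (NP p) (rnode NP (p @ [True]) B)" by (rule conn_edge) simp
    show ?thesis by (rule conn_trans[OF conn_sym[OF 1] conn_trans[OF 3 conn_trans[OF 4 2]]])
  qed
  then show ?thesis unfolding joinable_def by blast
qed

definition cut_between :: "sel list \<Rightarrow> nat \<Rightarrow> leaf \<Rightarrow> leaf \<Rightarrow> bool" where
  "cut_between \<Gamma> k l l' \<longleftrightarrow> k < length \<Gamma> \<and>
     (\<Gamma> ! k = Cut (Leaf l) (Leaf l') \<or> \<Gamma> ! k = Cut (Leaf l') (Leaf l))"

lemma cut_between_sym: "cut_between \<Gamma> k l l' \<Longrightarrow> cut_between \<Gamma> k l' l"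
  by (auto simp: cut_between_def)

lemma cut_conn:
  assumes "cut_between \<Gamma> k l l'"
  shows "conn (outer_graph s P \<Gamma> p) (NLeaf (fst l)) (NLeaf (fst l'))"
proof -
  have "(NC k, NLeaf (fst l)) \<in> sel_edges s k (\<Gamma> ! k)" "(NC k, NLeaf (fst l')) \<in> sel_edges s k (\<Gamma> ! k)"
    using assms by (auto simp: cut_between_def)
  then have "(NC k, NLeaf (fst l)) \<in> outer_graph s P \<Gamma> p" "(NC k, NLeaf (fst l')) \<in> outer_graph s P \<Gamma> p"
    using assms by (auto simp: cut_between_def outer_graph_def sw_graph_def)
  from conn_trans[OF conn_edge'[OF this(1)] conn_edge[OF this(2)]] show ?thesis .
qed

lemma cut_leaves_not_tens:
  assumes pg: "proof_graph P \<Gamma>" and sub: "subtree_at P p = Some (Tens A B)" and cut: "cut_between \<Gamma> k l l'"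
    and l: "l \<in> set (leaves A)" and l': "l' \<in> set (leaves B)"
  shows False
proof -
  from switch_to_leaf[OF l, of NP] obtain \<sigma>A where
    A: "\<And>s p. (\<forall>w. s (NP (p @ w)) = \<sigma>A w) \<Longrightarrow> conn (swedges s NP p A) (rnode NP p A) (NLeaf (fst l))" by blast
  from switch_to_leaf[OF l', of NP] obtain \<sigma>B where
    B: "\<And>s p. (\<forall>w. s (NP (p @ w)) = \<sigma>B w) \<Longrightarrow> conn (swedges s NP p B) (rnode NP p B) (NLeaf (fst l'))" by blast
  \<comment> \<open>Each factor is switched towards its cut leaf; the cut then connects the two
    factors outside the tensor.\<close>
  define s where "s = override (\<lambda>_. False) p (glue False \<sigma>A \<sigma>B)"
  have s: "s (NP (p @ w)) = glue False \<sigma>A \<sigma>B w" for w by (simp add: s_def)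
  let ?H = "outer_graph s P \<Gamma> p \<union> swedges s NP (p @ [False]) A \<union> swedges s NP (p @ [True]) B"
  have "conn (swedges s NP (p @ [False]) A) (rnode NP (p @ [False]) A) (NLeaf (fst l))" by (rule A) (simp add: s)
  then have 1: "conn ?H (rnode NP (p @ [False]) A) (NLeaf (fst l))" by (rule conn_mono) auto
  have "conn (swedges s NP (p @ [True]) B) (rnode NP (p @ [True]) B) (NLeaf (fst l'))" by (rule B) (simp add: s)
  then have 2: "conn ?H (rnode NP (p @ [True]) B) (NLeaf (fst l'))" by (rule conn_mono) auto
  have 3: "conn ?H (NLeaf (fst l)) (NLeaf (fst l'))" using cut_conn[OF cut] by (rule conn_mono) auto
  have "\<not> conn ?H (rnode NP (p @ [False]) A) (rnode NP (p @ [True]) B)"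
  proof (rule tens_separates(1)[OF pg sub])
    show "?H \<subseteq> sw_graph s P \<Gamma>" unfolding sw_graph_split[OF sub] by auto
    show "(NP p, b) \<notin> ?H" for b by (auto simp: outer_graph_def dest!: swedges_source)
  qed
  then show False using conn_trans[OF 1 conn_trans[OF 3 conn_sym[OF 2]]] by simp
qed

text \<open>Reaching \<open>\<bottom>\<close> otherwise than from a leaf of U closes a cycle in some switching.\<close>

lemma not_bot_side_cond:
  assumes pg: "proof_graph P \<Gamma>" and sub: "subtree_at P p = Some (Par U (Tens V' (Leaf (m, LBot))))"
    and neg: "\<not> bot_side_cond P \<Gamma> p U m"
  shows "\<exists>s. \<exists>q\<in>set (leaves U). conn (outer_graph s P \<Gamma> p) (NLeaf (fst q)) (NLeaf m)"
proof -
  let ?V = "Tens V' (Leaf (m, LBot))"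
  let ?e = "(NP (p @ [True]), NLeaf m)"
  have subV: "subtree_at P (p @ [True]) = Some ?V" using subtree_at_append[OF sub, of "[True]"] by simp
  from neg obtain s q0 where q0: "q0 \<in> tnodes NP (p @ [False]) U"
    "conn (sw_graph s P \<Gamma> - {?e}) q0 (NLeaf m)" by (auto simp: bot_side_cond_def)
  let ?W = "outer_graph s P \<Gamma> p" and ?D = "swedges s NP p (Par U ?V) - {?e}"
  let ?N = "{NP p, NP (p @ [True])} \<union> tnodes NP (p @ [False]) U \<union> tnodes NP (p @ [True, False]) V'"
  have D: "a \<in> ?N \<and> b \<in> ?N" if "(a, b) \<in> ?D" for a b
    using that swedges_tnodes[of s NP "p @ [False]" U] swedges_tnodes[of s NP "p @ [True, False]" V']
      rnode_in_tnodes[of NP "p @ [False]" U] rnode_in_tnodes[of NP "p @ [True, False]" V']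
    by (auto split: if_splits)
  have "conn (?W \<union> ?D) q0 (NLeaf m)"
    using q0(2) by (rule conn_mono) (auto simp: sw_graph_split[OF sub])
  \<comment> \<open>After the last edge used within the par the walk stays outside; \<open>y\<close>
    is the inner node where this last stretch begins.\<close>
  from conn_last_exit[OF this] have "\<exists>y. y \<in> ?N \<and> conn ?W y (NLeaf m)"
    using D q0(1) by blast
  then obtain y where y: "y \<in> ?N" "conn ?W y (NLeaf m)" by blast
  have sep: False if H: "H \<subseteq> sw_graph s' P \<Gamma>" "\<And>b. (NP (p @ [True]), b) \<notin> H"
    and c: "conn H (rnode NP (p @ [True, False]) V') (NLeaf m) \<or> conn H (NP (p @ [True])) (NLeaf m)" for H s'
    using tens_separates[OF pg subV H] c by auto
  have W: "conn (outer_graph (override s p \<sigma>) P \<Gamma> p \<union> E) y (NLeaf m)" for \<sigma> E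
    using y(2) by (rule conn_mono) (use outer_graph_override in blast)
  have "\<exists>q\<in>set (leaves U). y = NLeaf (fst q)"
  proof -
    from y(1) consider "\<exists>w. y = NP (p @ w)" | "\<exists>q\<in>set (leaves U). y = NLeaf (fst q)"
      | v where "v \<in> set (leaves V')" "y = NLeaf (fst v)"
      using tnodes_shape[of y NP "p @ [False]" U] tnodes_shape[of y NP "p @ [True, False]" V']
      by (auto simp: rnode.simps intro: exI[of _ "[]"])
    then show ?thesis
    proof cases
      case 1
      then obtain w where w: "y = NP (p @ w)" by blast
      show ?thesis
      proof (cases "w = []")
        case False
        \<comment> \<open>Such a node is isolated in the outer graph, so the walk from it has length
          zero.\<close>
        from y(2) have "y = NLeaf m"
          by (cases rule: converse_rtranclpE) (simp_all add: w outer_graph_isolated[OF False])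
        then show ?thesis using w by simp
      next
        case True
        \<comment> \<open>Switching the par to its right child leads from the root of the par to the
          tensor, and the outer connection leads back to its bottom.\<close>
        let ?s = "override s p (\<lambda>_. True)"
        let ?E = "{(NP p, NP (p @ [True]))}"
        let ?H = "outer_graph ?s P \<Gamma> p \<union> ?E"
        have sp: "?s (NP p)" using override_in[of s p _ "[]"] by simp
        have "conn ?H (NP (p @ [True])) (NP p)" by (rule conn_edge') simp
        with W[of "\<lambda>_. True" ?E] have "conn ?H (NP (p @ [True])) (NLeaf m)"
          using w True by (auto intro: conn_trans)
        moreover have "?H \<subseteq> sw_graph ?s P \<Gamma>" unfolding sw_graph_split[OF sub] using sp by auto
        moreover have "(NP (p @ [True]), b) \<notin> ?H" for b by (auto simp: outer_graph_def)
        ultimately have False using sep[of ?H ?s] by blast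
        then show ?thesis ..
      qed
    next
      case 3
      from switch_to_leaf[OF 3(1), of NP] obtain \<sigma> where
        \<sigma>: "\<And>s p. (\<forall>w. s (NP (p @ w)) = \<sigma> w) \<Longrightarrow> conn (swedges s NP p V') (rnode NP p V') (NLeaf (fst v))" by blast
      let ?\<sigma> = "glue False \<sigma> (glue False \<sigma> \<sigma>)"
      let ?s = "override s p ?\<sigma>"
      let ?E = "swedges ?s NP (p @ [True, False]) V'"
      let ?H = "outer_graph ?s P \<Gamma> p \<union> ?E"
      have "conn ?E (rnode NP (p @ [True, False]) V') y" unfolding 3(2)
        by (rule \<sigma>) simp
      then have "conn ?H (rnode NP (p @ [True, False]) V') y" by (rule conn_mono) auto
      with W[of ?\<sigma> ?E] have "conn ?H (rnode NP (p @ [True, False]) V') (NLeaf m)" by (rule conn_trans[rotated])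
      moreover have "?H \<subseteq> sw_graph ?s P \<Gamma>" unfolding sw_graph_split[OF sub] by auto
      moreover have "(NP (p @ [True]), b) \<notin> ?H" for b by (auto simp: outer_graph_def dest!: swedges_source)
      ultimately have False using sep[of ?H ?s] by blast
      then show ?thesis ..
    qed
  qed
  then show ?thesis using y(2) by auto
qed

text \<open>Such a connection would close a cycle at the tensor: from the root of \<open>V'\<close>
  to \<open>l'\<close>, through the cut to \<open>l\<close>, inside \<open>U\<close> to
  \<open>q\<close>, and outside to bottom \<open>m\<close>.\<close>

lemma joinable_not_conn:
  assumes pg: "proof_graph P \<Gamma>" and sub: "subtree_at P p = Some (Par U (Tens V' (Leaf (m, LBot))))"
    and cut: "cut_between \<Gamma> k l l'" and l': "l' \<in> set (leaves V')" and j: "joinable U l q"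
  shows "\<not> conn (outer_graph s P \<Gamma> p) (NLeaf (fst q)) (NLeaf m)"
proof
  assume qm: "conn (outer_graph s P \<Gamma> p) (NLeaf (fst q)) (NLeaf m)"
  have subV: "subtree_at P (p @ [True]) = Some (Tens V' (Leaf (m, LBot)))"
    using subtree_at_append[OF sub, of "[True]"] by simp
  from j obtain \<sigma>U where U: "\<And>s p. (\<forall>w. s (NP (p @ w)) = \<sigma>U w) \<Longrightarrow>
    conn (swedges s NP p U) (NLeaf (fst l)) (NLeaf (fst q))" unfolding joinable_def by blast
  from switch_to_leaf[OF l', of NP] obtain \<sigma> where
    V: "\<And>s p. (\<forall>w. s (NP (p @ w)) = \<sigma> w) \<Longrightarrow> conn (swedges s NP p V') (rnode NP p V') (NLeaf (fst l'))" by blast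
  define s' where "s' = override s p (glue False \<sigma>U (glue False \<sigma> \<sigma>))"
  have s': "s' (NP (p @ w)) = glue False \<sigma>U (glue False \<sigma> \<sigma>) w" for w by (simp add: s'_def)
  let ?H = "outer_graph s' P \<Gamma> p \<union> swedges s' NP (p @ [False]) U \<union> swedges s' NP (p @ [True, False]) V'"
  have "conn (swedges s' NP (p @ [False]) U) (NLeaf (fst l)) (NLeaf (fst q))" by (rule U) (simp add: s')
  then have 1: "conn ?H (NLeaf (fst l)) (NLeaf (fst q))" by (rule conn_mono) auto
  have "conn (swedges s' NP (p @ [True, False]) V') (rnode NP (p @ [True, False]) V') (NLeaf (fst l'))"
    by (rule V) (simp add: s')
  then have 2: "conn ?H (rnode NP (p @ [True, False]) V') (NLeaf (fst l'))" by (rule conn_mono) auto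
  have 3: "conn ?H (NLeaf (fst l')) (NLeaf (fst l))"
    using cut_conn[OF cut_between_sym[OF cut]] by (rule conn_mono) auto
  have 4: "conn ?H (NLeaf (fst q)) (NLeaf m)"
    using qm by (rule conn_mono) (unfold s'_def, use outer_graph_override in blast)
  have "\<not> conn ?H (rnode NP ((p @ [True]) @ [False]) V') (rnode NP ((p @ [True]) @ [True]) (Leaf (m, LBot)))"
  proof (rule tens_separates(1)[OF pg subV])
    show "?H \<subseteq> sw_graph s' P \<Gamma>" unfolding sw_graph_split[OF sub] by auto
    show "(NP (p @ [True]), b) \<notin> ?H" for b by (auto simp: outer_graph_def dest!: swedges_source)
  qed
  then show False using conn_trans[OF 2 conn_trans[OF 3 conn_trans[OF 1 4]]] by simp
qed

lemma bot_side_cond_joinable: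
  assumes "proof_graph P \<Gamma>" "subtree_at P p = Some (Par U (Tens V' (Leaf (m, LBot))))"
    "cut_between \<Gamma> k l l'" "l' \<in> set (leaves V')" "\<And>q. q \<in> set (leaves U) \<Longrightarrow> joinable U l q"
  shows "bot_side_cond P \<Gamma> p U m"
  using not_bot_side_cond[OF assms(1,2)] joinable_not_conn[OF assms(1-4)] assms(5) by blast

text \<open>The second alternative is stated for the commuted par because
  \<open>bot_side_cond\<close> speaks of a bottom in the right component.\<close>

lemma bot_side_cond_either:
  assumes pg: "proof_graph P \<Gamma>"
    and sub: "subtree_at P p = Some (Par (Tens U' (Leaf (n, LBot))) (Tens V' (Leaf (m, LBot))))"
    and cut: "cut_between \<Gamma> k l l'" and l: "l \<in> set (leaves U')" and l': "l' \<in> set (leaves V')"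
  shows "bot_side_cond P \<Gamma> p (Tens U' (Leaf (n, LBot))) m \<or>
    bot_side_cond (replace_at P p (Par (Tens V' (Leaf (m, LBot))) (Tens U' (Leaf (n, LBot))))) \<Gamma> p
      (Tens V' (Leaf (m, LBot))) n"
proof (rule ccontr)
  let ?U = "Tens U' (Leaf (n, LBot))" and ?V = "Tens V' (Leaf (m, LBot))"
  let ?Q = "replace_at P p (Par ?V ?U)"
  let ?W = "\<lambda>s. outer_graph s P \<Gamma> p"
  assume neg: "\<not> ?thesis"
  have subU: "subtree_at P (p @ [False]) = Some ?U" and subV: "subtree_at P (p @ [True]) = Some ?V"
    using subtree_at_append[OF sub, of "[False]"] subtree_at_append[OF sub, of "[True]"] by simp_all
  have pgQ: "proof_graph ?Q \<Gamma>" using eq_rule_step(1)[OF pg sub eq_rule.par_comm] .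
  have "\<exists>s. \<exists>q\<in>set (leaves ?V). conn (outer_graph s ?Q \<Gamma> p) (NLeaf (fst q)) (NLeaf n)"
    using not_bot_side_cond[OF pgQ subtree_at_replace[OF sub]] neg by blast
  \<comment> \<open>Commuting the par changes nothing outside it, so both failures are witnessed by
    outer graphs of the same linking.\<close>
  moreover have "outer_graph s ?Q \<Gamma> p = ?W s" for s by (rule outer_graph_replace[OF sub]) simp_all
  ultimately obtain s2 r where r: "r \<in> set (leaves ?V)" "conn (?W s2) (NLeaf (fst r)) (NLeaf n)"
    by metis
  from not_bot_side_cond[OF pg sub] neg obtain s1 q where
    q: "q \<in> set (leaves ?U)" "conn (?W s1) (NLeaf (fst q)) (NLeaf m)" by blast
  \<comment> \<open>Bottom \<open>n\<close> is joined to \<open>l\<close> by the tensor at the root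
    of \<open>?U\<close>, so it may stand for \<open>q\<close> in the cycle through the cut. In
    particular \<open>q\<close> is not bottom \<open>n\<close> and, below, \<open>r\<close> is not
    bottom \<open>m\<close>.\<close>
  have nm: "\<not> conn (?W s) (NLeaf n) (NLeaf m)" for s
    using joinable_not_conn[OF pg sub cut l' joinable_Tens[OF l, of "(n, LBot)"]] by simp
  have q': "q \<in> set (leaves U')" using q nm by auto
  from switch_to_leaf[OF q', of NP] obtain \<sigma>q where
    U: "\<And>s p. (\<forall>w. s (NP (p @ w)) = \<sigma>q w) \<Longrightarrow> conn (swedges s NP p U') (rnode NP p U') (NLeaf (fst q))" by blast
  have "\<exists>s. conn (?W s) (NLeaf n) (NLeaf m) \<or> conn (?W s) (NLeaf n) (NLeaf (fst q)) \<or>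
    conn (?W s) (NLeaf (fst q)) (NLeaf m) \<and> conn (?W s) (NLeaf n) (NLeaf (fst r))"
    by (rule switching_merge[OF _ _ q(2) conn_sym[OF r(2)]]) (fact outer_graph_local, fact outer_graph_uniq)
  then obtain s where "conn (?W s) (NLeaf n) (NLeaf m) \<or> conn (?W s) (NLeaf n) (NLeaf (fst q)) \<or>
    conn (?W s) (NLeaf (fst q)) (NLeaf m) \<and> conn (?W s) (NLeaf n) (NLeaf (fst r))" by blast
  then consider "conn (?W s) (NLeaf n) (NLeaf (fst q))"
    | "conn (?W s) (NLeaf (fst q)) (NLeaf m)" "conn (?W s) (NLeaf n) (NLeaf (fst r))" using nm by blast
  then show False
  proof cases
    case 1
    \<comment> \<open>Bottom \<open>n\<close> reaches a leaf of its own tensor partner from outside;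
      switching \<open>U'\<close> towards \<open>q\<close> closes a cycle at
      \<open>?U\<close>.\<close>
    define s' where "s' = override s p (glue False (glue False \<sigma>q \<sigma>q) \<sigma>q)"
    have s': "s' (NP (p @ w)) = glue False (glue False \<sigma>q \<sigma>q) \<sigma>q w" for w by (simp add: s'_def)
    let ?H = "?W s' \<union> swedges s' NP (p @ [False, False]) U'"
    have "conn (swedges s' NP (p @ [False, False]) U') (rnode NP (p @ [False, False]) U') (NLeaf (fst q))"
      by (rule U) (simp add: s')
    then have 2: "conn ?H (rnode NP (p @ [False, False]) U') (NLeaf (fst q))" by (rule conn_mono) auto
    have 3: "conn ?H (NLeaf n) (NLeaf (fst q))"
      using 1 by (rule conn_mono) (unfold s'_def, use outer_graph_override in blast)
    have "\<not> conn ?H (rnode NP ((p @ [False]) @ [False]) U') (rnode NP ((p @ [False]) @ [True]) (Leaf (n, LBot)))"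
    proof (rule tens_separates(1)[OF pg subU])
      show "?H \<subseteq> sw_graph s' P \<Gamma>" unfolding sw_graph_split[OF sub] by auto
    show "(NP (p @ [False]), b) \<notin> ?H" for b by (auto simp: outer_graph_def dest!: swedges_source)
    qed
    then show False using conn_trans[OF 2 conn_sym[OF 3]] by simp
  next
    case 2
    have r': "r \<in> set (leaves V')" using r(1) 2(2) nm by auto
    from switch_to_leaf[OF r', of NP] obtain \<sigma>r where
      V: "\<And>s p. (\<forall>w. s (NP (p @ w)) = \<sigma>r w) \<Longrightarrow> conn (swedges s NP p V') (rnode NP p V') (NLeaf (fst r))" by blast
    \<comment> \<open>The cycle at \<open>?V\<close> runs from the root of \<open>V'\<close> to
      \<open>r\<close>, outside to bottom \<open>n\<close>, over the tensor \<open>?U\<close> into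
      \<open>U'\<close> to \<open>q\<close>, and outside to bottom \<open>m\<close>.\<close>
    define s' where "s' = override s p (glue False (glue False \<sigma>q \<sigma>q) (glue False \<sigma>r \<sigma>r))"
    have s': "s' (NP (p @ w)) = glue False (glue False \<sigma>q \<sigma>q) (glue False \<sigma>r \<sigma>r) w" for w by (simp add: s'_def)
    let ?H = "?W s' \<union> swedges s' NP (p @ [False]) ?U \<union> swedges s' NP (p @ [True, False]) V'"
    have "conn (swedges s' NP (p @ [False, False]) U') (rnode NP (p @ [False, False]) U') (NLeaf (fst q))"
      by (rule U) (simp add: s')
    then have 3: "conn ?H (rnode NP (p @ [False, False]) U') (NLeaf (fst q))" by (rule conn_mono) auto
    have "conn (swedges s' NP (p @ [True, False]) V') (rnode NP (p @ [True, False]) V') (NLeaf (fst r))"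
      by (rule V) (simp add: s')
    then have 4: "conn ?H (rnode NP (p @ [True, False]) V') (NLeaf (fst r))" by (rule conn_mono) auto
    have 5: "conn ?H (NLeaf n) (NP (p @ [False]))" by (rule conn_edge') simp
    have 6: "conn ?H (NP (p @ [False])) (rnode NP (p @ [False, False]) U')" by (rule conn_edge) simp
    have 7: "conn ?H (NLeaf (fst q)) (NLeaf m)"
      using 2(1) by (rule conn_mono) (unfold s'_def, use outer_graph_override in blast)
    have 8: "conn ?H (NLeaf n) (NLeaf (fst r))"
      using 2(2) by (rule conn_mono) (unfold s'_def, use outer_graph_override in blast)
    have "\<not> conn ?H (rnode NP ((p @ [True]) @ [False]) V') (rnode NP ((p @ [True]) @ [True]) (Leaf (m, LBot)))"
    proof (rule tens_separates(1)[OF pg subV])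
      show "?H \<subseteq> sw_graph s' P \<Gamma>" unfolding sw_graph_split[OF sub] by auto
    show "(NP (p @ [True]), b) \<notin> ?H" for b by (auto simp: outer_graph_def dest!: swedges_source)
    qed
    then show False
      using conn_trans[OF 4 conn_trans[OF conn_sym[OF 8] conn_trans[OF 5 conn_trans[OF 6 conn_trans[OF 3 7]]]]]
      by simp
  qed
qed

section \<open>Bringing the two sides of a cut together\<close>

text \<open>The component that the reduction expects for \<open>l\<close>: a bare \<open>1\<close>,
  or the leaf with its tensor partner. The order of the tensor is left open and fixed by
  commutativity at the end.\<close>

definition block :: "leaf \<Rightarrow> tree \<Rightarrow> bool" where
  "block l T \<longleftrightarrow> (if snd l = LOne then T = Leaf l else \<exists>Q. T = Tens Q (Leaf l) \<or> T = Tens (Leaf l) Q)"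

text \<open>The three outcomes decide the next move: stop, reassociate the par, or move out a bottom
  that is split off from the part containing \<open>l\<close>.\<close>

lemma linking_cases:
  assumes "is_linking T" "l \<in> set (leaves T)"
  obtains "block l T" | A B where "T = Par A B"
  | T' n where "T = Tens T' (Leaf (n, LBot)) \<or> T = Tens (Leaf (n, LBot)) T'" "l \<in> set (leaves T')"
  using assms(1)
proof cases
  case (lk_one i)
  then show ?thesis using assms(2) that(1) by (simp add: block_def)
next
  case (lk_ax1 i a j)
  then show ?thesis using assms(2) that(1) by (auto simp: block_def)
next
  case (lk_ax2 i a j)
  then show ?thesis using assms(2) that(1) by (auto simp: block_def)
next
  case (lk_botl L i)
  show ?thesis
  proof (cases "l \<in> set (leaves L)")
    case True
    then show ?thesis using lk_botl that(3)[of L i] by blast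
  next
    case False
    then have "l = (i, LBot)" using lk_botl assms(2) by auto
    then have "block l T" using lk_botl by (auto simp: block_def)
    then show ?thesis by (rule that(1))
  qed
next
  case (lk_botr L i)
  show ?thesis
  proof (cases "l \<in> set (leaves L)")
    case True
    then show ?thesis using lk_botr that(3)[of L i] by blast
  next
    case False
    then have "l = (i, LBot)" using lk_botr assms(2) by auto
    then have "block l T" using lk_botr by (auto simp: block_def)
    then show ?thesis by (rule that(1))
  qed
next
  case (lk_par L1 L2)
  then show ?thesis using that(2) by blast
qed

text \<open>A block is either \<open>l\<close> alone or a tensor with \<open>l\<close> as one
  factor, which joins \<open>l\<close> to all leaves of the other factor. So a block on the left
  guarantees the side condition for a bottom on the right.\<close>

lemma block_joinable:
  assumes "block l U" "q \<in> set (leaves U)"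
  shows "joinable U l q"
proof (cases "snd l = LOne")
  case True
  then show ?thesis using assms by (simp add: block_def joinable_refl)
next
  case False
  then obtain Q where "U = Tens Q (Leaf l) \<or> U = Tens (Leaf l) Q" using assms(1) by (auto simp: block_def)
  then show ?thesis
    using assms(2) joinable_Tens[of l "Leaf l" q Q] joinable_sym[OF joinable_Tens[of q Q l "Leaf l"]]
      joinable_refl[of U l] by auto
qed

section \<open>Single moves on a par that separates the two cut leaves\<close>

lemma replace_left:
  assumes "proof_graph P \<Gamma>" "subtree_at P p = Some (Par U V)" "eq_rule U U'"
  shows "\<exists>P'. pg_equiv \<Gamma> P P' \<and> proof_graph P' \<Gamma> \<and> subtree_at P' p = Some (Par U' V)"
proof -
  have sub: "subtree_at P (p @ [False]) = Some U" using subtree_at_append[OF assms(2), of "[False]"] by simp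
  have "replace_at P (p @ [False]) U' = replace_at P p (Par U' V)"
    using replace_at_append[OF assms(2), of "[False]" U'] by simp
  then show ?thesis
    using eq_rule_step[OF assms(1) sub assms(3)] subtree_at_replace[OF assms(2)] by metis
qed

lemma replace_right:
  assumes "proof_graph P \<Gamma>" "subtree_at P p = Some (Par U V)" "eq_rule V V'"
  shows "\<exists>P'. pg_equiv \<Gamma> P P' \<and> proof_graph P' \<Gamma> \<and> subtree_at P' p = Some (Par U V')"
proof -
  have sub: "subtree_at P (p @ [True]) = Some V" using subtree_at_append[OF assms(2), of "[True]"] by simp
  have "replace_at P (p @ [True]) V' = replace_at P p (Par U V')"
    using replace_at_append[OF assms(2), of "[True]" V'] by simp
  then show ?thesis
    using eq_rule_step[OF assms(1) sub assms(3)] subtree_at_replace[OF assms(2)] by metis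
qed

lemma replace_root:
  assumes "proof_graph P \<Gamma>" "subtree_at P p = Some X" "eq_rule X Y"
  shows "\<exists>P'. pg_equiv \<Gamma> P P' \<and> proof_graph P' \<Gamma> \<and> subtree_at P' p = Some Y"
  using eq_rule_step[OF assms] subtree_at_replace[OF assms(2)] by metis

text \<open>Commutativity brings the half containing \<open>l\<close> next to \<open>V\<close>;
  associativity then makes a smaller par of the two, one step to the right of
  \<open>p\<close>.\<close>

lemma par_step:
  assumes pg: "proof_graph P \<Gamma>" and sub: "subtree_at P p = Some (Par (Par U1 U2) V)"
    and l: "l \<in> set (leaves (Par U1 U2))"
  shows "\<exists>P' U'. pg_equiv \<Gamma> P P' \<and> proof_graph P' \<Gamma> \<and> subtree_at P' (p @ [True]) = Some (Par U' V) \<and>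
    l \<in> set (leaves U') \<and> length (leaves U') < length (leaves (Par U1 U2))"
proof -
  have pos: "0 < length (leaves T)" for T by (induction T) auto
  have assoc: "\<exists>P'. pg_equiv \<Gamma> Q P' \<and> proof_graph P' \<Gamma> \<and> subtree_at P' (p @ [True]) = Some (Par B V)"
    if "proof_graph Q \<Gamma>" "subtree_at Q p = Some (Par (Par A B) V)" for Q A B
  proof -
    from replace_root[OF that eq_rule.par_assoc] obtain P' where P': "pg_equiv \<Gamma> Q P'" "proof_graph P' \<Gamma>"
      "subtree_at P' p = Some (Par A (Par B V))" by blast
    with subtree_at_append[OF P'(3), of "[True]"] show ?thesis by auto
  qed
  show ?thesis
  proof (cases "l \<in> set (leaves U2)")
    case True
    then show ?thesis using assoc[OF pg sub] pos[of U1] by auto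
  next
    case False
    from replace_left[OF pg sub eq_rule.par_comm] obtain Q where Q: "pg_equiv \<Gamma> P Q" "proof_graph Q \<Gamma>"
      "subtree_at Q p = Some (Par (Par U2 U1) V)" by blast
    from assoc[OF Q(2,3)] obtain P' where P': "pg_equiv \<Gamma> Q P'" "proof_graph P' \<Gamma>"
      "subtree_at P' (p @ [True]) = Some (Par U1 V)" by blast
    show ?thesis
      by (rule exI[of _ P'], rule exI[of _ U1])
        (use P' pg_equiv_trans[OF Q(1) P'(1)] False l pos[of U2] in auto)
  qed
qed

lemma bot_par_step:
  assumes "proof_graph P \<Gamma>" and sub: "subtree_at P p = Some (Par U (Tens V' (Leaf (m, LBot))))"
    and "bot_side_cond P \<Gamma> p U m"
  shows "\<exists>P'. pg_equiv \<Gamma> P P' \<and> proof_graph P' \<Gamma> \<and> subtree_at P' (p @ [False]) = Some (Par U V')"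
proof -
  let ?P = "replace_at P p (Tens (Par U V') (Leaf (m, LBot)))"
  have "subtree_at ?P (p @ [False]) = Some (Par U V')"
    using subtree_at_append[OF subtree_at_replace[OF sub], where q = "[False]"] by simp
  then show ?thesis using bot_step[OF assms] by blast
qed

definition adjacent_blocks :: "sel list \<Rightarrow> tree \<Rightarrow> leaf \<Rightarrow> leaf \<Rightarrow> bool" where
  "adjacent_blocks \<Gamma> P l l' \<longleftrightarrow> (\<exists>P' p A B. pg_equiv \<Gamma> P P' \<and> proof_graph P' \<Gamma> \<and>
     subtree_at P' p = Some (Par A B) \<and> block l A \<and> block l' B)"

lemma adjacent_blocks_sym:
  assumes "adjacent_blocks \<Gamma> P l l'"
  shows "adjacent_blocks \<Gamma> P l' l"
proof -
  from assms obtain Q p A B where Q: "pg_equiv \<Gamma> P Q" "proof_graph Q \<Gamma>"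
    "subtree_at Q p = Some (Par A B)" "block l A" "block l' B" unfolding adjacent_blocks_def by blast
  from replace_root[OF Q(2,3) eq_rule.par_comm] obtain P' where "pg_equiv \<Gamma> Q P'" "proof_graph P' \<Gamma>"
    "subtree_at P' p = Some (Par B A)" by blast
  with Q pg_equiv_trans[OF Q(1)] show ?thesis unfolding adjacent_blocks_def by blast
qed

lemma adjacent_blocks_equiv:
  "pg_equiv \<Gamma> P Q \<Longrightarrow> adjacent_blocks \<Gamma> Q l l' \<Longrightarrow> adjacent_blocks \<Gamma> P l l'"
  unfolding adjacent_blocks_def using pg_equiv_trans by blast

lemma normalise_right:
  assumes "proof_graph P \<Gamma>" "subtree_at P p = Some (Par U V)"
    "V = Tens V' (Leaf l) \<or> V = Tens (Leaf l) V'"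
  shows "\<exists>P'. pg_equiv \<Gamma> P P' \<and> proof_graph P' \<Gamma> \<and> subtree_at P' p = Some (Par U (Tens V' (Leaf l)))"
  using assms(3)
proof
  assume "V = Tens V' (Leaf l)"
  then show ?thesis using assms(1,2) pg_equiv_refl by blast
next
  assume "V = Tens (Leaf l) V'"
  then show ?thesis using replace_right[OF assms(1,2)] eq_rule.tens_comm by blast
qed

lemma normalise_left:
  assumes "proof_graph P \<Gamma>" "subtree_at P p = Some (Par U V)"
    "U = Tens U' (Leaf l) \<or> U = Tens (Leaf l) U'"
  shows "\<exists>P'. pg_equiv \<Gamma> P P' \<and> proof_graph P' \<Gamma> \<and> subtree_at P' p = Some (Par (Tens U' (Leaf l)) V)"
  using assms(3)
proof
  assume "U = Tens U' (Leaf l)"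
  then show ?thesis using assms(1,2) pg_equiv_refl by blast
next
  assume "U = Tens (Leaf l) U'"
  then show ?thesis using replace_left[OF assms(1,2)] eq_rule.tens_comm by blast
qed

lemma block_bot_step:
  assumes pg: "proof_graph P \<Gamma>" and sub: "subtree_at P p = Some (Par U V)"
    and cut: "cut_between \<Gamma> k l l'" and blk: "block l U"
    and V: "V = Tens V' (Leaf (m, LBot)) \<or> V = Tens (Leaf (m, LBot)) V'" and l': "l' \<in> set (leaves V')"
  shows "\<exists>P'. pg_equiv \<Gamma> P P' \<and> proof_graph P' \<Gamma> \<and> subtree_at P' (p @ [False]) = Some (Par U V')"
proof -
  from normalise_right[OF pg sub V] obtain Q where Q: "pg_equiv \<Gamma> P Q" "proof_graph Q \<Gamma>"
    "subtree_at Q p = Some (Par U (Tens V' (Leaf (m, LBot))))" by blast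
  have "bot_side_cond Q \<Gamma> p U m"
    using bot_side_cond_joinable[OF Q(2,3) cut l'] block_joinable[OF blk] by blast
  from bot_par_step[OF Q(2,3) this] show ?thesis using pg_equiv_trans[OF Q(1)] by blast
qed

text \<open>Each move drops leaves from the par that separates \<open>l\<close> and
  \<open>l'\<close>, so the number of leaves below it is the measure. The position moves along, and
  the cut leaves are generalised because commuting the par swaps their roles.\<close>

lemma cut_adjacent_blocks:
  "proof_graph P \<Gamma> \<Longrightarrow> cut_between \<Gamma> k l l' \<Longrightarrow> subtree_at P p = Some (Par U V) \<Longrightarrow>
    l \<in> set (leaves U) \<Longrightarrow> l' \<in> set (leaves V) \<Longrightarrow> adjacent_blocks \<Gamma> P l l'"
proof (induction "length (leaves U) + length (leaves V)" arbitrary: P p U V l l' rule: less_induct)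
  case less
  note pg = less.prems(1) and cut = less.prems(2) and sub = less.prems(3)
    and l = less.prems(4) and l' = less.prems(5)
  have IH: "adjacent_blocks \<Gamma> P l l'"
    if "pg_equiv \<Gamma> P P'" "proof_graph P' \<Gamma>" "subtree_at P' p' = Some (Par U' V')"
      "l \<in> set (leaves U')" "l' \<in> set (leaves V')"
      "length (leaves U') + length (leaves V') < length (leaves U) + length (leaves V)" for P' p' U' V'
    using less.hyps[OF that(6,2) cut that(3,4,5)] adjacent_blocks_equiv[OF that(1)] by blast
  \<comment> \<open>The mirrored hypothesis, for moves that leave \<open>l'\<close> in the left
    component.\<close>
  have IH': "adjacent_blocks \<Gamma> P l l'"
    if "pg_equiv \<Gamma> P P'" "proof_graph P' \<Gamma>" "subtree_at P' p' = Some (Par V' U')"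
      "l \<in> set (leaves U')" "l' \<in> set (leaves V')"
      "length (leaves V') + length (leaves U') < length (leaves U) + length (leaves V)" for P' p' U' V'
    using less.hyps[OF that(6,2) cut_between_sym[OF cut] that(3,5,4)] adjacent_blocks_equiv[OF that(1)]
      adjacent_blocks_sym by blast
  have lkX: "is_linking (Par U V)" using pg sub by (auto simp: proof_graph_def intro: is_linking_subtree)
  then have lk: "is_linking U" "is_linking V" by (auto elim: is_linking_ParE)
  from replace_root[OF pg sub eq_rule.par_comm] obtain S where
    S: "pg_equiv \<Gamma> P S" "proof_graph S \<Gamma>" "subtree_at S p = Some (Par V U)" by blast
  from linking_cases[OF lk(1) l] show ?case
  proof cases
    case (2 U1 U2)
    from par_step[OF pg sub[unfolded 2], of l] l obtain P' U' where P': "pg_equiv \<Gamma> P P'" "proof_graph P' \<Gamma>"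
      "subtree_at P' (p @ [True]) = Some (Par U' V)" "l \<in> set (leaves U')"
      "length (leaves U') < length (leaves (Par U1 U2))" unfolding 2 by blast
    show ?thesis by (rule IH[OF P'(1-4) l']) (use P'(5) 2 in simp)
  next
    case U: 1
    from linking_cases[OF lk(2) l'] show ?thesis
    proof cases
      case 1
      then show ?thesis unfolding adjacent_blocks_def using pg sub U pg_equiv_refl by blast
    next
      case (2 V1 V2)
      from par_step[OF S(2) S(3)[unfolded 2], of l'] l' obtain P' V' where P': "pg_equiv \<Gamma> S P'" "proof_graph P' \<Gamma>"
        "subtree_at P' (p @ [True]) = Some (Par V' U)" "l' \<in> set (leaves V')"
        "length (leaves V') < length (leaves (Par V1 V2))" unfolding 2 by blast
      show ?thesis by (rule IH'[OF pg_equiv_trans[OF S(1) P'(1)] P'(2,3) l P'(4)]) (use P'(5) 2 in simp)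
    next
      case (3 V' m)
      from block_bot_step[OF pg sub cut U 3] obtain P' where P': "pg_equiv \<Gamma> P P'" "proof_graph P' \<Gamma>"
        "subtree_at P' (p @ [False]) = Some (Par U V')" by blast
      show ?thesis by (rule IH[OF P' l 3(2)]) (use 3(1) in auto)
    qed
  next
    case U: (3 U' n)
    from linking_cases[OF lk(2) l'] show ?thesis
    proof cases
      case 1
      from block_bot_step[OF S(2,3) cut_between_sym[OF cut] 1 U] obtain P' where
        P': "pg_equiv \<Gamma> S P'" "proof_graph P' \<Gamma>" "subtree_at P' (p @ [False]) = Some (Par V U')" by blast
      show ?thesis by (rule IH'[OF pg_equiv_trans[OF S(1) P'(1)] P'(2,3) U(2) l']) (use U(1) in auto)
    next
      case (2 V1 V2)
      from par_step[OF S(2) S(3)[unfolded 2], of l'] l' obtain P' V' where P': "pg_equiv \<Gamma> S P'" "proof_graph P' \<Gamma>"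
        "subtree_at P' (p @ [True]) = Some (Par V' U)" "l' \<in> set (leaves V')"
        "length (leaves V') < length (leaves (Par V1 V2))" unfolding 2 by blast
      show ?thesis by (rule IH'[OF pg_equiv_trans[OF S(1) P'(1)] P'(2,3) l P'(4)]) (use P'(5) 2 in simp)
    next
      case V: (3 V' m)
      let ?U = "Tens U' (Leaf (n, LBot))" and ?V = "Tens V' (Leaf (m, LBot))"
      from normalise_left[OF pg sub U(1)] obtain Q where Q: "pg_equiv \<Gamma> P Q" "proof_graph Q \<Gamma>"
        "subtree_at Q p = Some (Par ?U V)" by blast
      from normalise_right[OF Q(2,3) V(1)] obtain R where R: "pg_equiv \<Gamma> Q R" "proof_graph R \<Gamma>"
        "subtree_at R p = Some (Par ?U ?V)" by blast
      have PR: "pg_equiv \<Gamma> P R" by (rule pg_equiv_trans[OF Q(1) R(1)])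
      have len: "length (leaves U) = length (leaves ?U)" "length (leaves V) = length (leaves ?V)"
        using U(1) V(1) by auto
      let ?R = "replace_at R p (Par ?V ?U)"
      \<comment> \<open>Neither side is a block yet, so a particular bottom may be stuck; but one of
        the two can always leave.\<close>
      from bot_side_cond_either[OF R(2,3) cut U(2) V(2)] show ?thesis
      proof
        assume "bot_side_cond R \<Gamma> p ?U m"
        from bot_par_step[OF R(2,3) this] obtain P' where P': "pg_equiv \<Gamma> R P'" "proof_graph P' \<Gamma>"
          "subtree_at P' (p @ [False]) = Some (Par ?U V')" by blast
        show ?thesis by (rule IH[OF pg_equiv_trans[OF PR P'(1)] P'(2,3) _ V(2)]) (use U(2) len in auto)
      next
        assume side: "bot_side_cond ?R \<Gamma> p ?V n"
        note step = eq_rule_step[OF R(2,3) eq_rule.par_comm]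
        from bot_par_step[OF step(1) subtree_at_replace[OF R(3)] side] obtain P' where
          P': "pg_equiv \<Gamma> ?R P'" "proof_graph P' \<Gamma>" "subtree_at P' (p @ [False]) = Some (Par ?V U')" by blast
        show ?thesis
          by (rule IH'[OF pg_equiv_trans[OF PR pg_equiv_trans[OF step(2) P'(1)]] P'(2,3) U(2)])
            (use V(2) len in auto)
      qed
    qed
  qed
qed

section \<open>From the meeting point of the cut leaves to a ready cut\<close>

lemma leaves_meet:
  assumes "l \<in> set (leaves T)" "l' \<in> set (leaves T)" "l \<noteq> l'"
  shows "\<exists>p A B. (subtree_at T p = Some (Par A B) \<or> subtree_at T p = Some (Tens A B)) \<and>
    (l \<in> set (leaves A) \<and> l' \<in> set (leaves B) \<or> l' \<in> set (leaves A) \<and> l \<in> set (leaves B))"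
  using assms
proof (induction T)
  case (Tens A B)
  consider "l \<in> set (leaves A)" "l' \<in> set (leaves A)" | "l \<in> set (leaves B)" "l' \<in> set (leaves B)"
    | "l \<in> set (leaves A) \<and> l' \<in> set (leaves B) \<or> l' \<in> set (leaves A) \<and> l \<in> set (leaves B)"
    using Tens.prems by auto
  then show ?case
  proof cases
    case 1
    from Tens.IH(1)[OF this Tens.prems(3)] show ?thesis by (metis subtree_at.simps(3))
  next
    case 2
    from Tens.IH(2)[OF this Tens.prems(3)] show ?thesis by (metis subtree_at.simps(4))
  next
    case 3
    then show ?thesis by (metis subtree_at.simps(1))
  qed
next
  case (Par A B)
  consider "l \<in> set (leaves A)" "l' \<in> set (leaves A)" | "l \<in> set (leaves B)" "l' \<in> set (leaves B)"
    | "l \<in> set (leaves A) \<and> l' \<in> set (leaves B) \<or> l' \<in> set (leaves A) \<and> l \<in> set (leaves B)"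
    using Par.prems by auto
  then show ?case
  proof cases
    case 1
    from Par.IH(1)[OF this Par.prems(3)] show ?thesis by (metis subtree_at.simps(5))
  next
    case 2
    from Par.IH(2)[OF this Par.prems(3)] show ?thesis by (metis subtree_at.simps(6))
  next
    case 3
    then show ?thesis by (metis subtree_at.simps(1))
  qed
qed simp

lemma cut_between_adjacent_blocks:
  assumes pg: "proof_graph P \<Gamma>" and cut: "cut_between \<Gamma> k l l'" and ne: "l \<noteq> l'"
  shows "adjacent_blocks \<Gamma> P l l'"
proof -
  have "\<Gamma> ! k \<in> set \<Gamma>" using cut by (simp add: cut_between_def)
  moreover have "set (leaves P) = set (concat (map sel_leaves \<Gamma>))" using pg by (simp add: proof_graph_def)
  ultimately have "set (sel_leaves (\<Gamma> ! k)) \<subseteq> set (leaves P)" by auto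
  then have "l \<in> set (leaves P)" "l' \<in> set (leaves P)" using cut by (auto simp: cut_between_def)
  from leaves_meet[OF this ne] obtain p A B where
    "subtree_at P p = Some (Par A B) \<or> subtree_at P p = Some (Tens A B)"
    and m: "l \<in> set (leaves A) \<and> l' \<in> set (leaves B) \<or> l' \<in> set (leaves A) \<and> l \<in> set (leaves B)" by blast
  then have "subtree_at P p = Some (Par A B)"
    using cut_leaves_not_tens[OF pg _ cut] cut_leaves_not_tens[OF pg _ cut_between_sym[OF cut]] by blast
  then show ?thesis
    using m cut_adjacent_blocks[OF pg cut] cut_adjacent_blocks[OF pg cut_between_sym[OF cut]] adjacent_blocks_sym
    by blast
qed

lemma atom_cut_ready:
  assumes pg: "proof_graph P \<Gamma>" and cut: "cut_between \<Gamma> k (i, PosAt a) (j, NegAt a)"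
  shows "\<exists>P'. pg_equiv \<Gamma> P P' \<and> proof_graph P' \<Gamma> \<and> ready P' \<Gamma> k"
proof -
  from cut_between_adjacent_blocks[OF pg cut] obtain Q p A B where Q: "pg_equiv \<Gamma> P Q" "proof_graph Q \<Gamma>"
    "subtree_at Q p = Some (Par A B)" and blk: "block (i, PosAt a) A" "block (j, NegAt a) B"
    unfolding adjacent_blocks_def by auto
  have "is_linking (Par A B)" using Q by (auto simp: proof_graph_def intro: is_linking_subtree)
  then have lk: "is_linking A" "is_linking B" by (auto elim: is_linking_ParE)
  let ?A = "\<lambda>h. Tens (Leaf (h, NegAt a)) (Leaf (i, PosAt a))"
  let ?B = "\<lambda>m. Tens (Leaf (j, NegAt a)) (Leaf (m, PosAt a))"
  \<comment> \<open>In a linking, an atom directly below a tensor belongs to an axiom link, so its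
    partner is the dual atom of the same name.\<close>
  from blk(1) lk(1) obtain h where A: "A = ?A h \<or> A = Tens (Leaf (i, PosAt a)) (Leaf (h, NegAt a))"
    by (auto simp: block_def elim!: is_linking_TensE is_linking_LeafE)
  from blk(2) lk(2) obtain m where B: "B = ?B m \<or> B = Tens (Leaf (m, PosAt a)) (Leaf (j, NegAt a))"
    by (auto simp: block_def elim!: is_linking_TensE is_linking_LeafE)
  from normalise_left[OF Q(2,3), of "Leaf (h, NegAt a)" "(i, PosAt a)"] A obtain R where
    R: "pg_equiv \<Gamma> Q R" "proof_graph R \<Gamma>" "subtree_at R p = Some (Par (?A h) B)" by auto
  from normalise_right[OF R(2,3), of "Leaf (j, NegAt a)" "(m, PosAt a)"] B obtain S where
    S: "pg_equiv \<Gamma> R S" "proof_graph S \<Gamma>" "subtree_at S p = Some (Par (?A h) (?B m))" by auto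
  have "reducible_cut S (Leaf (i, PosAt a)) (Leaf (j, NegAt a))"
    using S(3) unfolding reducible_cut_def is_subtree_def by blast
  then have "ready S \<Gamma> k" using cut by (auto simp: cut_between_def ready_def)
  then show ?thesis using S(2) pg_equiv_trans[OF Q(1) pg_equiv_trans[OF R(1) S(1)]] by blast
qed

lemma unit_cut_ready:
  assumes pg: "proof_graph P \<Gamma>" and cut: "cut_between \<Gamma> k (i, LBot) (j, LOne)"
  shows "\<exists>P'. pg_equiv \<Gamma> P P' \<and> proof_graph P' \<Gamma> \<and> ready P' \<Gamma> k"
proof -
  from cut_between_adjacent_blocks[OF pg cut] obtain Q p A B where Q: "pg_equiv \<Gamma> P Q" "proof_graph Q \<Gamma>"
    "subtree_at Q p = Some (Par A B)" and blk: "block (i, LBot) A" "block (j, LOne) B"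
    unfolding adjacent_blocks_def by auto
  from blk have B: "B = Leaf (j, LOne)" by (simp add: block_def)
  from blk obtain C where "A = Tens C (Leaf (i, LBot)) \<or> A = Tens (Leaf (i, LBot)) C" by (auto simp: block_def)
  from normalise_left[OF Q(2,3) this] obtain R where
    R: "pg_equiv \<Gamma> Q R" "proof_graph R \<Gamma>" "subtree_at R p = Some (Par (Tens C (Leaf (i, LBot))) B)" by auto
  have "reducible_cut R (Leaf (i, LBot)) (Leaf (j, LOne))"
    using R(3) unfolding reducible_cut_def is_subtree_def B by blast
  then have "ready R \<Gamma> k" using cut by (auto simp: cut_between_def ready_def)
  then show ?thesis using R(2) pg_equiv_trans[OF Q(1) R(1)] by blast
qed

theorem theorem1p16:
  assumes "proof_graph P \<Gamma>"
    and "k < length \<Gamma>"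
    and "is_cut (\<Gamma> ! k)"
  shows "\<exists>P'. pg_equiv \<Gamma> P P' \<and> proof_graph P' \<Gamma> \<and> ready P' \<Gamma> k"
proof -
  from assms(3) obtain A B where cut: "\<Gamma> ! k = Cut A B" by (cases "\<Gamma> ! k") auto
  then have "is_dual A B" using assms(1,2) by (auto simp: proof_graph_def dest!: spec[of _ k])
  then show ?thesis
  proof cases
    case (du_pn i a j)
    then show ?thesis using atom_cut_ready[OF assms(1), of k i a j] cut assms(2) by (auto simp: cut_between_def)
  next
    case (du_np i a j)
    then show ?thesis using atom_cut_ready[OF assms(1), of k j a i] cut assms(2) by (auto simp: cut_between_def)
  next
    case (du_ob i j)
    then show ?thesis using unit_cut_ready[OF assms(1), of k j i] cut assms(2) by (auto simp: cut_between_def)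
  next
    case (du_bo i j)
    then show ?thesis using unit_cut_ready[OF assms(1), of k i j] cut assms(2) by (auto simp: cut_between_def)
  next
    case (du_pt A A' B B')
    then have "ready P \<Gamma> k" using cut assms(2) by (simp add: ready_def reducible_cut_def)
    then show ?thesis using assms(1) pg_equiv_refl by blast
  next
    case (du_tp A A' B B')
    then have "ready P \<Gamma> k" using cut assms(2) by (simp add: ready_def reducible_cut_def)
    then show ?thesis using assms(1) pg_equiv_refl by blast
  qed
qed

end
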